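(* Let $k$ be a positive odd integer, and let $n(k)=10$ if $k=1$ and $n(k)=2k+4$ if $k\ge 3$. Let $G$ be a connected 1-binding graph of order $n\ge n(k)$. If $$\rho(G)\ \ge\ \rho\bigl(K_1\vee(K_{n-2k-2}\cup kK_2\cup K_1)\bigr),$$ then for every set $W\subseteq V(G)$ with an even number of vertices, $G$ contains a spanning subgraph $F=F_W$ such that $d_F(u)\in\{1,3,\ldots,k\}$ for all $u\in W$ and $d_F(v)\in\{0,2,\ldots,k+1\}$ for all $v\in V(G)-W$, unless $G=K_1\vee(K_{n-2k-2}\cup kK_2\cup K_1)$.
   Context: All graphs are finite, simple and undirected. The order of $G$ is $|V(G)|$. $d_F(v)$ is the degree of $v$ in $F$. A spanning subgraph of $G$ is a subgraph with vertex set $V(G)$. For $S\subseteq V(G)$, $N_G(S)$ is the set of vertices of $G$ adjacent to at least one vertex of $S$ (it may contain vertices of $S$). The binding number of $G$ is $$\mathrm{bind}(G)=\min\left\{\frac{|N_G(S)|}{|S|}:\ \emptyset\ne S\subseteq V(G),\ N_G(S)\ne V(G)\right\},$$ and for a positive real number $r$, $G$ is called $r$-binding if $\mathrm{bind}(G)\ge r$; so $G$ is 1-binding if $\mathrm{bind}(G)\ge 1$. $\rho(G)$ denotes the spectral radius of $G$, i.e. the largest eigenvalue of the adjacency matrix $A(G)$. $K_m$ is the complete graph on $m$ vertices, $G_1\cup G_2$ is the disjoint union of graphs, $mH$ is the disjoint union of $m$ copies of $H$, and $G_1\vee G_2$ is the join (the disjoint union together with all edges between $V(G_1)$ and $V(G_2)$).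 Equality of graphs means isomorphism. *)

theory Defs
  imports
    "Graph_Theory.Graph_Theory"
    "Jordan_Normal_Form.Spectral_Radius"
begin

text \<open>
  Finite simple undirected graphs are the symmetric loop-free digraphs \<^locale>\<open>pair_graph\<close>: an edge
  \<open>uv\<close> is the pair of arcs \<open>(u,v)\<close>, \<open>(v,u)\<close>, so \<^const>\<open>out_degree\<close> is the usual degree.
\<close>

definition neighbourhood :: "'a pair_pre_digraph \<Rightarrow> 'a set \<Rightarrow> 'a set" where
  "neighbourhood G S = {v \<in> pverts G. \<exists>u\<in>S. (u, v) \<in> parcs G}"

definition binding_number :: "'a pair_pre_digraph \<Rightarrow> real" where
  "binding_number G =
     Min {real (card (neighbourhood G S)) / real (card S) | S.
            S \<noteq> {} \<and> S \<subseteq> pverts G \<and> neighbourhood G S \<noteq> pverts G}"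

definition r_binding :: "real \<Rightarrow> 'a pair_pre_digraph \<Rightarrow> bool" where
  "r_binding r G \<longleftrightarrow> binding_number G \<ge> r"

text \<open>The list \<open>vs\<close> fixes the order in which the vertices label rows and columns.\<close>

definition adjacency_matrix :: "'a list \<Rightarrow> 'a pair_pre_digraph \<Rightarrow> real mat" where
  "adjacency_matrix vs G =
     mat (length vs) (length vs) (\<lambda>(i, j). if (vs ! i, vs ! j) \<in> parcs G then 1 else 0)"

text \<open>
  The ordering chosen below is immaterial, see \<open>graph_spectral_radius_eq\<close>. The spectrum is that of
  a real matrix, i.e. the set of its real eigenvalues; since adjacency matrices of undirected graphs
  are symmetric, these are all the eigenvalues.
\<close>

definition graph_spectral_radius :: "'a pair_pre_digraph \<Rightarrow> real" where
  "graph_spectral_radius G =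
     Max (spectrum (adjacency_matrix (SOME vs. distinct vs \<and> set vs = pverts G) G))"

definition complete_graph :: "nat \<Rightarrow> nat pair_pre_digraph" where
  "complete_graph m = \<lparr> pverts = {..<m}, parcs = {(i, j). i < m \<and> j < m \<and> i \<noteq> j} \<rparr>"

definition disjoint_union ::
  "'a pair_pre_digraph \<Rightarrow> 'b pair_pre_digraph \<Rightarrow> ('a + 'b) pair_pre_digraph" where
  "disjoint_union G H =
     \<lparr> pverts = pverts G <+> pverts H,
       parcs = {(Inl u, Inl v) | u v. (u, v) \<in> parcs G} \<union>
               {(Inr u, Inr v) | u v. (u, v) \<in> parcs H} \<rparr>"

definition copies :: "nat \<Rightarrow> 'a pair_pre_digraph \<Rightarrow> (nat \<times> 'a) pair_pre_digraph" where
  "copies m G =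
     \<lparr> pverts = {..<m} \<times> pverts G,
       parcs = {((i, u), (i, v)) | i u v. i < m \<and> (u, v) \<in> parcs G} \<rparr>"

definition graph_join ::
  "'a pair_pre_digraph \<Rightarrow> 'b pair_pre_digraph \<Rightarrow> ('a + 'b) pair_pre_digraph" where
  "graph_join G H =
     \<lparr> pverts = pverts G <+> pverts H,
       parcs = parcs (disjoint_union G H) \<union>
               {(Inl u, Inr v) | u v. u \<in> pverts G \<and> v \<in> pverts H} \<union>
               {(Inr v, Inl u) | u v. u \<in> pverts G \<and> v \<in> pverts H} \<rparr>"

text \<open>\<open>K\<^sub>1 \<or> (K\<^bsub>n-2k-2\<^esub> \<union> k K\<^sub>2 \<union> K\<^sub>1)\<close>; the subtraction truncates unless \<open>n \<ge> 2 * k + 2\<close>.\<close>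

definition extremal_graph ::
  "nat \<Rightarrow> nat \<Rightarrow> (nat + ((nat + nat \<times> nat) + nat)) pair_pre_digraph" where
  "extremal_graph n k =
     graph_join (complete_graph 1)
       (disjoint_union
          (disjoint_union (complete_graph (n - 2 * k - 2)) (copies k (complete_graph 2)))
          (complete_graph 1))"


lemma pair_graph_iff:
  "pair_graph G \<longleftrightarrow> finite (pverts G) \<and> parcs G \<subseteq> pverts G \<times> pverts G \<and> sym (parcs G) \<and> irrefl (parcs G)"
proof
  assume "pair_graph G"
  then interpret pair_graph G .
  show "finite (pverts G) \<and> parcs G \<subseteq> pverts G \<times> pverts G \<and> sym (parcs G) \<and> irrefl (parcs G)"
    using pair_finite_verts in_arcsD1 in_arcsD2 arcs_symmetric
    by (auto simp: sym_def irrefl_def dest: no_loops')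
next
  assume *: "finite (pverts G) \<and> parcs G \<subseteq> pverts G \<times> pverts G \<and> sym (parcs G) \<and> irrefl (parcs G)"
  then have "finite (parcs G)" by (meson finite_SigmaI finite_subset)
  with * show "pair_graph G"
    by unfold_locales (auto simp: symmetric_def irrefl_def)
qed

lemma pair_graph_complete_graph: "pair_graph (complete_graph m)"
  by (auto simp: pair_graph_iff complete_graph_def sym_def irrefl_def)

lemma pair_graph_disjoint_union:
  "pair_graph G \<Longrightarrow> pair_graph H \<Longrightarrow> pair_graph (disjoint_union G H)"
  by (auto simp: pair_graph_iff disjoint_union_def sym_def irrefl_def)

lemma pair_graph_copies: "pair_graph G \<Longrightarrow> pair_graph (copies m G)"
  by (auto simp: pair_graph_iff copies_def sym_def irrefl_def)

lemma pair_graph_graph_join: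
  "pair_graph G \<Longrightarrow> pair_graph H \<Longrightarrow> pair_graph (graph_join G H)"
  by (auto simp: pair_graph_iff graph_join_def disjoint_union_def sym_def irrefl_def)

lemma pair_graph_extremal_graph: "pair_graph (extremal_graph n k)"
  unfolding extremal_graph_def
  by (intro pair_graph_graph_join pair_graph_disjoint_union pair_graph_copies pair_graph_complete_graph)

lemma card_extremal_graph: "n \<ge> 2 * k + 2 \<Longrightarrow> card (pverts (extremal_graph n k)) = n"
  by (simp add: extremal_graph_def graph_join_def disjoint_union_def copies_def complete_graph_def
      card_Plus card_cartesian_product)

lemma binding_number_set_finite_nonempty:
  assumes "pair_graph G" "pverts G \<noteq> {}"
  defines "R \<equiv> {real (card (neighbourhood G S)) / real (card S) | S.
            S \<noteq> {} \<and> S \<subseteq> pverts G \<and> neighbourhood G S \<noteq> pverts G}"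
  shows "finite R" "R \<noteq> {}"
proof -
  have G: "finite (pverts G)" "irrefl (parcs G)" using assms(1) by (auto simp: pair_graph_iff)
  have "R \<subseteq> (\<lambda>S. real (card (neighbourhood G S)) / real (card S)) ` Pow (pverts G)"
    by (auto simp: R_def)
  then show "finite R" by (rule finite_subset) (use G in auto)
  obtain v where "v \<in> pverts G" using assms(2) by auto
  moreover from this G have "neighbourhood G {v} \<noteq> pverts G"
    by (auto simp: neighbourhood_def irrefl_def)
  ultimately show "R \<noteq> {}" unfolding R_def by blast
qed

lemma eigenvalue_adjacency_matrix_iff:
  assumes "distinct vs" "set vs = pverts G"
  shows "eigenvalue (adjacency_matrix vs G) x \<longleftrightarrow>
    (\<exists>f. (\<exists>v\<in>pverts G. f v \<noteq> 0) \<and>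
         (\<forall>u\<in>pverts G. (\<Sum>v\<in>pverts G. (if (u, v) \<in> parcs G then 1 else 0) * f v) = x * f u))"
    (is "?L \<longleftrightarrow> ?R")
proof -
  let ?n = "length vs"
  let ?A = "adjacency_matrix vs G"
  have bij: "bij_betw ((!) vs) {..<?n} (pverts G)"
    using bij_betw_nth[OF assms(1), of "{..<?n}" "pverts G"] assms(2) by auto
  have row: "(?A *\<^sub>v vec ?n (\<lambda>i. f (vs ! i))) $ i =
      (\<Sum>v\<in>pverts G. (if (vs ! i, v) \<in> parcs G then 1 else 0) * f v)" if "i < ?n" for i f
    using that
    by (subst sum.reindex_bij_betw[OF bij, symmetric])
       (simp add: adjacency_matrix_def scalar_prod_def atLeast0LessThan)
  have dim: "dim_row ?A = ?n" by (simp add: adjacency_matrix_def)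
  have all: "(\<forall>u\<in>pverts G. P u) \<longleftrightarrow> (\<forall>i<?n. P (vs ! i))" for P
    using assms(2) by (metis in_set_conv_nth)
  have ex: "(\<exists>u\<in>pverts G. P u) \<longleftrightarrow> (\<exists>i<?n. P (vs ! i))" for P
    using assms(2) by (metis in_set_conv_nth)
  have key: "eigenvector ?A (vec ?n (\<lambda>i. f (vs ! i))) x \<longleftrightarrow>
      (\<exists>v\<in>pverts G. f v \<noteq> 0) \<and>
      (\<forall>u\<in>pverts G. (\<Sum>v\<in>pverts G. (if (u, v) \<in> parcs G then 1 else 0) * f v) = x * f u)" for f
  proof -
    have 1: "vec ?n (\<lambda>i. f (vs ! i)) \<noteq> 0\<^sub>v ?n \<longleftrightarrow> (\<exists>v\<in>pverts G. f v \<noteq> 0)"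
      unfolding ex by (auto simp: vec_eq_iff)
    have 2: "?A *\<^sub>v vec ?n (\<lambda>i. f (vs ! i)) = x \<cdot>\<^sub>v vec ?n (\<lambda>i. f (vs ! i)) \<longleftrightarrow>
        (\<forall>i<?n. (?A *\<^sub>v vec ?n (\<lambda>i. f (vs ! i))) $ i = x * f (vs ! i))"
      by (subst vec_eq_iff) (use dim in auto)
    show ?thesis
      unfolding eigenvector_def dim 1 2 all by (simp add: row cong: conj_cong)
  qed
  show ?thesis
  proof
    assume ?L
    then obtain w where w: "eigenvector ?A w x" unfolding eigenvalue_def by auto
    define f where "f v = w $ (the_inv_into {..<?n} ((!) vs) v)" for v
    have "f (vs ! i) = w $ i" if "i < ?n" for i
      using that bij by (simp add: f_def bij_betw_def the_inv_into_f_f)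
    then have "vec ?n (\<lambda>i. f (vs ! i)) = w"
      using w dim by (auto simp: eigenvector_def)
    with w key[of f] show ?R by auto
  next
    assume ?R
    with key show ?L unfolding eigenvalue_def by blast
  qed
qed

lemma graph_spectral_radius_eq:
  assumes "distinct vs" "set vs = pverts G"
  shows "graph_spectral_radius G = Max (spectrum (adjacency_matrix vs G))"
proof -
  let ?ws = "SOME ws. distinct ws \<and> set ws = pverts G"
  have "distinct ?ws \<and> set ?ws = pverts G"
    by (rule someI[of _ vs]) (use assms in auto)
  then have "spectrum (adjacency_matrix ?ws G) = spectrum (adjacency_matrix vs G)"
    unfolding spectrum_def
    using eigenvalue_adjacency_matrix_iff[of ?ws G] eigenvalue_adjacency_matrix_iff[OF assms] by auto
  then show ?thesis by (simp add: graph_spectral_radius_def)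
qed

end

theory Submission
  imports Defs
begin

text \<open>
  Suppose that for some even \<open>W\<close> the required subgraph does not exist. Give every vertex of \<open>W\<close> the
  capacity \<open>k\<close> and every other vertex the capacity \<open>k + 1\<close>; the task is to find a spanning subgraph
  whose degrees have the parity of the capacities and do not exceed them. Replace each vertex by a
  clique with as many vertices as its capacity, and each edge by all edges between the two cliques.
  The edges of \<open>G\<close> that carry an odd number of edges of a perfect matching of this blow-up form such a
  subgraph, so the blow-up has no perfect matching. Its order is even because \<open>k\<close> is odd and \<open>W\<close> is
  even, hence at least two vertices stay unmatched, and a Tutte--Berge argument
  (\<open>matching_deficiency\<close>) gives a vertex set whose deletion leaves at least two more separate pieces
  than it has vertices. Projecting to \<open>G\<close> yields a set \<open>S\<close>, nonempty since \<open>G\<close> is connected, such that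
  \<open>G - S\<close> falls apart into at least \<open>k * card S + 2\<close> parts with no edges between them
  (\<open>parity_factor_or_closed_parts\<close>).

  The rest of the proof shows that then \<open>G\<close> is the extremal graph. Write \<open>s = card S\<close>. A part with a
  single vertex has all its neighbours in \<open>S\<close>, so the binding condition allows at most \<open>s\<close> such parts
  (\<open>binding_singleton_parts\<close>). The spectral radius is bounded by a test vector: if \<open>y\<close> is positive and
  \<open>A y \<le> r y\<close> for the adjacency matrix \<open>A\<close>, then no eigenvalue exceeds \<open>r\<close>, and if \<open>G\<close> is connected and
  \<open>r\<close> is an eigenvalue then \<open>A y = r y\<close>. Take \<open>y = 1\<close> on \<open>S\<close> and \<open>y = s / (r + 1 - c)\<close> on a part with \<open>c\<close>
  vertices. This solves the eigenvalue equation exactly on the parts if they are cliques joined to \<open>S\<close>,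
  and what remains is a single inequality about the part sizes (\<open>partition_spectral_bound\<close>):
  \<open>s - 1 + (\<Sum>c. c * s / (r + 1 - c)) \<le> r\<close>.

  Let \<open>L = n - 2 * k - 2\<close>. The extremal graph has an eigenvalue \<open>r > L\<close>, the root of
  \<open>r = 1 / r + 2 * k / (r - 1) + L / (r + 1 - L)\<close>. The summand \<open>c / (r + 1 - c)\<close> is convex in \<open>c\<close>, so it
  may be replaced by a chord. For \<open>s \<ge> 2\<close> this proves the inequality already with \<open>L\<close> in place of \<open>r\<close>
  (\<open>several_hubs_bound\<close>), contradicting the hypothesis on the spectral radius. For \<open>s = 1\<close> it
  proves the inequality for the root \<open>r\<close>, with equality only for the part sizes \<open>1, 2, ..., 2, L\<close>
  (\<open>one_hub_bound\<close>). Equality does hold, because \<open>r\<close> is at most the spectral radius of \<open>G\<close>; then all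
  edges that the parts permit are present, and \<open>G\<close> is the extremal graph (\<open>extremal_graph_iso\<close>).
\<close>

section \<open>Matchings and closed parts\<close>

text \<open>
  Edges of a matching are two-element sets, so that \<open>\<Union>M\<close> is the set of covered vertices.
\<close>

definition matching_in :: "'a rel \<Rightarrow> 'a set \<Rightarrow> 'a set set \<Rightarrow> bool" where
  "matching_in R V M \<longleftrightarrow>
     disjoint M \<and> (\<forall>e\<in>M. \<exists>u v. e = {u, v} \<and> u \<in> V \<and> v \<in> V \<and> u \<noteq> v \<and> (u, v) \<in> R)"

definition maximum_matching :: "'a rel \<Rightarrow> 'a set \<Rightarrow> 'a set set \<Rightarrow> bool" where
  "maximum_matching R V M \<longleftrightarrow>
     matching_in R V M \<and> (\<forall>N. matching_in R V N \<longrightarrow> card N \<le> card M)"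

text \<open>
  Each member of \<open>P\<close> is a union of components of the graph after deletion of \<open>S\<close>. Lower bounds on the
  number of components can be stated with such families, and merging members or projecting them from a
  blow-up gives such families again.
\<close>

definition closed_parts :: "'a rel \<Rightarrow> 'a set \<Rightarrow> 'a set \<Rightarrow> 'a set set \<Rightarrow> bool" where
  "closed_parts R V S P \<longleftrightarrow>
     disjoint P \<and> {} \<notin> P \<and> \<Union>P \<subseteq> V - S \<and>
     (\<forall>C\<in>P. \<forall>u\<in>C. \<forall>v\<in>V - S. (u, v) \<in> R \<longrightarrow> v \<in> C)"

lemma matching_in_subset: "matching_in R V M \<Longrightarrow> N \<subseteq> M \<Longrightarrow> matching_in R V N"
  by (auto simp: matching_in_def disjoint_def)

lemma matching_in_Union: "matching_in R V M \<Longrightarrow> \<Union>M \<subseteq> V"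
  by (fastforce simp: matching_in_def)

lemma matching_in_insert:
  assumes "matching_in R V M" "u \<in> V" "v \<in> V" "u \<noteq> v" "(u, v) \<in> R" "u \<notin> \<Union>M" "v \<notin> \<Union>M"
  shows "matching_in R V (insert {u, v} M)"
  unfolding matching_in_def
proof
  show "disjoint (insert {u, v} M)"
    using assms unfolding matching_in_def disjoint_def by auto
  show "\<forall>e\<in>insert {u, v} M. \<exists>u v. e = {u, v} \<and> u \<in> V \<and> v \<in> V \<and> u \<noteq> v \<and> (u, v) \<in> R"
    using assms unfolding matching_in_def by blast
qed

lemma matching_in_finite:
  assumes "finite V" "matching_in R V M" shows "finite M"
  using assms matching_in_Union finite_UnionD finite_subset by metis

lemma card_Union_matching:
  assumes "finite V" "matching_in R V M" shows "card (\<Union>M) = 2 * card M"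
proof -
  have two: "card e = 2" if "e \<in> M" for e
    using that assms(2) by (auto simp: matching_in_def)
  have "card (\<Union>M) = sum card M"
    using assms(2) two by (intro card_Union_disjoint) (auto simp: matching_in_def intro: card_ge_0_finite)
  then show ?thesis using two by simp
qed

lemma maximum_matching_exists:
  assumes "finite V" shows "\<exists>M. maximum_matching R V M"
proof -
  have "card M \<le> card V" if "matching_in R V M" for M
    using card_Union_matching[OF assms that] card_mono[OF assms matching_in_Union[OF that]] by linarith
  moreover have "matching_in R V {}" by (auto simp: matching_in_def)
  ultimately show ?thesis
    unfolding maximum_matching_def
    using ex_has_greatest_nat[of "matching_in R V" "{}" card "Suc (card V)"] by (metis le_imp_less_Suc less_imp_le)
qed

text \<open>
  This is the transitivity step in the exchange proof of the Tutte--Berge formula: being missed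
  together by a maximum matching passes from \<open>{u, v}\<close> to \<open>{t, u}\<close> or \<open>{t, v}\<close>. Among the maximum
  matchings that miss \<open>t\<close> choose \<open>N\<close> with as many edges in common with \<open>M\<close> as possible. If \<open>N\<close> covered
  both \<open>u\<close> and \<open>v\<close>, then, \<open>M\<close> and \<open>N\<close> being equally large, \<open>M\<close> would cover a vertex \<open>x\<close> other than \<open>t\<close>
  that \<open>N\<close> misses, and exchanging an edge of \<open>N\<close> for the edge of \<open>M\<close> at \<open>x\<close> would increase the overlap.
\<close>

lemma missed_common_or_exchange:
  assumes V: "finite V"
    and M: "maximum_matching R V M" "u \<notin> \<Union>M" "v \<notin> \<Union>M" "u \<noteq> v"
    and t: "maximum_matching R V N0" "t \<notin> \<Union>N0"
  shows "\<exists>N. maximum_matching R V N \<and> t \<notin> \<Union>N \<and> (u \<notin> \<Union>N \<or> v \<notin> \<Union>N)"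
proof (cases "t \<in> \<Union>M")
  case False
  then show ?thesis using M by (intro exI[of _ M]) auto
next
  case tM: True
  have mM: "matching_in R V M" and finM: "finite M"
    using M matching_in_finite[OF V] by (auto simp: maximum_matching_def)
  have bound: "\<forall>N. maximum_matching R V N \<and> t \<notin> \<Union>N \<longrightarrow> card (M \<inter> N) < Suc (card M)"
    using finM by (simp add: card_mono le_imp_less_Suc)
  obtain N where N: "maximum_matching R V N" "t \<notin> \<Union>N"
    and Nmax: "\<And>N'. maximum_matching R V N' \<Longrightarrow> t \<notin> \<Union>N' \<Longrightarrow> card (M \<inter> N') \<le> card (M \<inter> N)"
    using ex_has_greatest_nat[of "\<lambda>N. maximum_matching R V N \<and> t \<notin> \<Union>N" N0
        "\<lambda>N. card (M \<inter> N)" "Suc (card M)"] t bound by (metis less_imp_le)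
  have mN: "matching_in R V N" and finN: "finite N"
    using N matching_in_finite[OF V] by (auto simp: maximum_matching_def)
  have cardMN: "card M = card N" using M N by (auto simp: maximum_matching_def intro: le_antisym)
  have finU: "finite (\<Union>M)" "finite (\<Union>N)"
    using mM mN matching_in_Union V finite_subset by metis+
  have False if uv: "u \<in> \<Union>N" "v \<in> \<Union>N"
  proof -
    have "card (\<Union>M - \<Union>N) = card (\<Union>N - \<Union>M)"
      using card_Union_matching[OF V mM] card_Union_matching[OF V mN] cardMN finU
      by (simp add: card_Diff_subset_Int Int_commute)
    moreover have "card {u, v} \<le> card (\<Union>N - \<Union>M)"
      using uv M finU by (intro card_mono) auto
    ultimately have "\<not> \<Union>M - \<Union>N \<subseteq> {t}"
      using M(4) card_mono[of "{t}" "\<Union>M - \<Union>N"] by auto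
    then obtain x e where x: "x \<noteq> t" "x \<notin> \<Union>N" "e \<in> M" "x \<in> e" by blast
    obtain y where y: "e = {x, y}" "x \<in> V" "y \<in> V" "x \<noteq> y" "(x, y) \<in> R \<or> (y, x) \<in> R"
    proof -
      obtain a b where "e = {a, b}" "a \<in> V" "b \<in> V" "a \<noteq> b" "(a, b) \<in> R"
        using mM x(3) unfolding matching_in_def by blast
      with x(4) that show ?thesis by (metis insertE insert_commute singletonD)
    qed
    have ins: "matching_in R V (insert e N')" if "matching_in R V N'" "x \<notin> \<Union>N'" "y \<notin> \<Union>N'" for N'
      using matching_in_insert[OF that(1), of x y] matching_in_insert[OF that(1), of y x] y that
      by (auto simp: insert_commute)
    \<comment> \<open>Otherwise \<open>e\<close> could be added to the maximum matching \<open>N\<close>.\<close>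
    have yN: "y \<in> \<Union>N"
    proof (rule ccontr)
      assume "y \<notin> \<Union>N"
      then have "matching_in R V (insert e N)" using ins mN x by blast
      then have "card (insert e N) \<le> card N" using N by (auto simp: maximum_matching_def)
      moreover have "e \<notin> N" using x by blast
      ultimately show False using finN by simp
    qed
    then obtain f where f: "f \<in> N" "y \<in> f" by blast
    have yf: "y \<notin> \<Union>(N - {f})"
      using mN f unfolding matching_in_def disjoint_def by blast
    define N' where "N' = insert e (N - {f})"
    have "matching_in R V N'"
      unfolding N'_def
    proof (rule ins)
      show "matching_in R V (N - {f})" by (rule matching_in_subset[OF mN]) auto
      show "x \<notin> \<Union>(N - {f})" using x(2) by auto
    qed (rule yf)
    moreover have "card N' = card N"
      unfolding N'_def using finN f x card.remove[OF finN f(1)] by (subst card_insert_disjoint) auto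
    ultimately have "maximum_matching R V N'" using N by (auto simp: maximum_matching_def)
    moreover have "y \<noteq> t" using N(2) yN by auto
    then have "t \<notin> \<Union>N'" using N(2) x(1) y(1) unfolding N'_def by simp
    ultimately have le: "card (M \<inter> N') \<le> card (M \<inter> N)" by (rule Nmax)
    have "f \<notin> M"
    proof
      assume "f \<in> M"
      moreover have "e \<inter> f \<noteq> {}" using f(2) y(1) by auto
      ultimately have "f = e" using mM x(3) unfolding matching_in_def disjoint_def by metis
      then show False using f(1) x by auto
    qed
    then have "M \<inter> N' = insert e (M \<inter> N)" unfolding N'_def using x by blast
    moreover have "e \<notin> M \<inter> N" using x by blast
    ultimately have "card (M \<inter> N') = Suc (card (M \<inter> N))" using finM by simp
    with le show False by simp
  qed
  then show ?thesis using N by (intro exI[of _ N]) auto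
qed

text \<open>
  The nontrivial half of the Tutte--Berge formula, without the parity of the parts. If some vertex is
  covered by every maximum matching, it is deleted and put into \<open>U\<close>. If there is no such vertex, then
  "equal or never missed together" is an equivalence relation, by the previous lemma; adjacent
  vertices are related, since otherwise their edge could be added to a maximum matching. So the
  classes of the \<open>card V - 2 * card M\<close> vertices missed by \<open>M\<close> are closed, they are pairwise distinct, and
  they serve as \<open>P\<close> with \<open>U = {}\<close>.
\<close>

lemma matching_deficiency:
  assumes "finite V"
  shows "\<exists>M U P. matching_in R V M \<and> U \<subseteq> V \<and> closed_parts R V U P \<and>
           card U + card V \<le> card P + 2 * card M"
  using assms
proof (induction "card V" arbitrary: V rule: less_induct)
  case (less V)
  obtain M where M: "maximum_matching R V M" using maximum_matching_exists[OF less.prems] by blast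
  then have mM: "matching_in R V M" by (simp add: maximum_matching_def)
  show ?case
  proof (cases "\<exists>v\<in>V. \<forall>N. maximum_matching R V N \<longrightarrow> v \<in> \<Union>N")
    case True
    then obtain v where v: "v \<in> V" "\<And>N. maximum_matching R V N \<Longrightarrow> v \<in> \<Union>N" by blast
    have cardV: "card (V - {v}) < card V" "card V = Suc (card (V - {v}))"
      using v less.prems card.remove[of V v] by (simp_all add: card_Diff1_less)
    obtain N U P where N: "matching_in R (V - {v}) N" and U: "U \<subseteq> V - {v}"
      and P: "closed_parts R (V - {v}) U P" and le: "card U + card (V - {v}) \<le> card P + 2 * card N"
      using less.hyps[OF cardV(1)] less.prems by auto
    have mN: "matching_in R V N" using N unfolding matching_in_def by blast
    moreover have "v \<notin> \<Union>N" using matching_in_Union[OF N] by blast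
    ultimately have "\<not> maximum_matching R V N" using v(2)[of N] by auto
    with mN M have "card N \<le> card M" "card N \<noteq> card M" by (auto simp: maximum_matching_def)
    then have "card N < card M" by simp
    moreover have "card (insert v U) = Suc (card U)"
      using U less.prems by (subst card_insert_disjoint) (auto intro: finite_subset)
    ultimately have "card (insert v U) + card V \<le> card P + 2 * card M" using le cardV by linarith
    moreover have "closed_parts R V (insert v U) P"
      using P unfolding closed_parts_def Diff_insert2[of V v U] .
    ultimately show ?thesis using mM U v by (metis Diff_subset insert_subset subset_trans)
  next
    case False
    define T where "T u w \<longleftrightarrow> u = w \<or> (\<forall>N. maximum_matching R V N \<longrightarrow> u \<in> \<Union>N \<or> w \<in> \<Union>N)" for u w
    have T_sym: "T u w \<Longrightarrow> T w u" for u w by (auto simp: T_def)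
    have T_trans: "T u w" if T: "T u t" "T t w" "t \<in> V" for u t w
    proof (rule ccontr)
      assume not: "\<not> T u w"
      then obtain N where N: "maximum_matching R V N" "u \<notin> \<Union>N" "w \<notin> \<Union>N" "u \<noteq> w" by (auto simp: T_def)
      obtain N0 where "maximum_matching R V N0" "t \<notin> \<Union>N0" using False T(3) by blast
      from missed_common_or_exchange[OF less.prems N this]
      obtain N1 where N1: "maximum_matching R V N1" "t \<notin> \<Union>N1" "u \<notin> \<Union>N1 \<or> w \<notin> \<Union>N1" by blast
      have "u \<noteq> t" "t \<noteq> w" using not T by auto
      then show False using T N1 unfolding T_def by (metis (no_types))
    qed
    have T_adj: "T u w" if "(u, w) \<in> R" "u \<in> V" "w \<in> V" for u w
    proof (rule ccontr)
      assume "\<not> T u w"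
      then obtain N where N: "maximum_matching R V N" "u \<notin> \<Union>N" "w \<notin> \<Union>N" "u \<noteq> w" by (auto simp: T_def)
      then have "matching_in R V (insert {u, w} N)"
        using that by (intro matching_in_insert) (auto simp: maximum_matching_def)
      then have "card (insert {u, w} N) \<le> card N" using N by (auto simp: maximum_matching_def)
      moreover have "finite N" "{u, w} \<notin> N"
        using N matching_in_finite[OF less.prems] by (auto simp: maximum_matching_def)
      ultimately show False by simp
    qed
    define cls where "cls v = {w \<in> V. T w v}" for v
    define P where "P = cls ` (V - \<Union>M)"
    have ne: "\<not> T v w" if "v \<in> V - \<Union>M" "w \<in> V - \<Union>M" "v \<noteq> w" for v w
      using that M by (auto simp: T_def)
    have disj: "cls v \<inter> cls w = {}" if "v \<in> V - \<Union>M" "w \<in> V - \<Union>M" "v \<noteq> w" for v w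
    proof (rule ccontr)
      assume "cls v \<inter> cls w \<noteq> {}"
      then obtain x where "T x v" "T x w" "x \<in> V" unfolding cls_def by blast
      then show False using ne[OF that] T_sym T_trans[of v x w] by simp
    qed
    have self: "v \<in> cls v" if "v \<in> V" for v using that by (simp add: cls_def T_def)
    have "inj_on cls (V - \<Union>M)"
    proof (rule inj_onI, rule ccontr)
      fix v w assume "v \<in> V - \<Union>M" "w \<in> V - \<Union>M" "cls v = cls w" "v \<noteq> w"
      with disj[of v w] self[of v] show False by auto
    qed
    then have "card P = card (V - \<Union>M)" unfolding P_def by (rule card_image)
    moreover have "card (V - \<Union>M) + 2 * card M = card V"
      using card_Union_matching[OF less.prems mM] matching_in_Union[OF mM] less.prems
      by (metis card_Diff_subset card_mono finite_subset le_add_diff_inverse2)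
    moreover have "closed_parts R V {} P"
      unfolding closed_parts_def
    proof (intro conjI ballI impI)
      show "disjoint P" unfolding P_def disjoint_def using disj by blast
      show "{} \<notin> P" using self unfolding P_def by fastforce
      show "\<Union>P \<subseteq> V - {}" unfolding P_def cls_def by blast
      fix C u w assume C: "C \<in> P" "u \<in> C" "w \<in> V - {}" "(u, w) \<in> R"
      then obtain v where v: "C = cls v" "T u v" "u \<in> V" unfolding P_def cls_def by blast
      have "T w u" using T_adj[of u w] T_sym[of u w] C v by simp
      then have "T w v" using T_trans[of w u v] v by blast
      then show "w \<in> C" using v C by (simp add: cls_def)
    qed
    ultimately show ?thesis using mM by (intro exI[of _ M] exI[of _ "{}"] exI[of _ P]) auto
  qed
qed

section \<open>Subgraphs with prescribed degree parities\<close>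

text \<open>
  The blow-up \<open>V'\<close> has \<open>f v\<close> copies of each vertex \<open>v\<close>, which form a clique. For a perfect matching let
  \<open>m u v\<close> be the number of its edges between copies of \<open>u\<close> and copies of \<open>v\<close>. Counting the copies of \<open>u\<close>
  gives \<open>f u = 2 * m u u + (\<Sum>v\<noteq>u. m u v)\<close>, so the edges \<open>uv\<close> with \<open>m u v\<close> odd form the desired
  subgraph. Without a perfect matching the parity of the order of \<open>V'\<close> turns a deficiency of at
  least one into at least two. A set \<open>U\<close> of copies separates \<open>V'\<close> as the set \<open>S\<close> of those vertices
  does whose copies are all in \<open>U\<close>, because the remaining copies of any other vertex lie together in
  one part or outside all parts.
\<close>

lemma parity_subgraph_or_closed_parts:
  fixes f :: "'a \<Rightarrow> nat"
  assumes V: "finite V" and R: "sym R" and ev: "even (sum f V)"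
  shows "(\<exists>E. E \<subseteq> R \<inter> V \<times> V \<and> sym E \<and> irrefl E \<and>
            (\<forall>u\<in>V. card {v. (u, v) \<in> E} \<le> f u \<and> (even (card {v. (u, v) \<in> E}) \<longleftrightarrow> even (f u))))
       \<or> (\<exists>S P. S \<subseteq> V \<and> closed_parts R V S P \<and> sum f S + 2 \<le> card P)"
proof -
  define V' where "V' = Sigma V (\<lambda>v. {..<f v})"
  define R' :: "('a \<times> nat) rel" where "R' = {((u, i), (v, j)) | u i v j. (u, v) \<in> R \<or> u = v}"
  have V'fin: "finite V'" using V by (simp add: V'_def)
  have cardV': "card V' = sum f V" unfolding V'_def using V by simp
  from matching_deficiency[OF V'fin] obtain M U P where M: "matching_in R' V' M" and U: "U \<subseteq> V'"
    and P: "closed_parts R' V' U P" and le: "card U + card V' \<le> card P + 2 * card M" by metis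
  have UM: "card (\<Union>M) = 2 * card M" and sub: "\<Union>M \<subseteq> V'" and finM: "finite M"
    using card_Union_matching[OF V'fin M] matching_in_Union[OF M] matching_in_finite[OF V'fin M] by auto
  have "2 * card M \<le> card V'" using card_mono[OF V'fin sub] UM by simp
  moreover obtain b where "card V' = 2 * b" using ev cardV' evenE by metis
  ultimately have "2 * card M = card V' \<or> card U + 2 \<le> card P" using le by presburger
  then consider "2 * card M = card V'" | "card U + 2 \<le> card P" by blast
  then show ?thesis
  proof cases
    case 1
    then have perfect: "\<Union>M = V'" using card_subset_eq[OF V'fin sub] UM by simp
    \<comment> \<open>Here \<open>N u v\<close> consists of the matching edges between copies of \<open>u\<close> and copies of \<open>v\<close>; for \<open>u = v\<close>
        such an edge covers two copies of \<open>u\<close>, which is where the factor 2 below comes from.\<close>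
    define N where "N u v = {e \<in> M. \<exists>i j. e = {(u, i), (v, j)}}" for u v
    define m where "m u v = card (N u v)" for u v
    define E where "E = {(u, v). u \<in> V \<and> v \<in> V \<and> u \<noteq> v \<and> odd (m u v)}"
    have N_sym: "N u v = N v u" for u v unfolding N_def by (auto simp: insert_commute)
    have disjM: "pairwise (\<lambda>e e'. e \<inter> e' = {}) M"
      using conjunct1[OF M[unfolded matching_in_def]] by (simp add: disjnt_def pairwise_def)
    have edge: "\<exists>u i v j. e = {(u, i), (v, j)} \<and> u \<in> V \<and> v \<in> V \<and> (u, i) \<noteq> (v, j) \<and> ((u, v) \<in> R \<or> u = v)"
      if e: "e \<in> M" for e
    proof -
      obtain x y where "e = {x, y}" "x \<in> V'" "y \<in> V'" "x \<noteq> y" "(x, y) \<in> R'"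
        using bspec[OF conjunct2[OF M[unfolded matching_in_def]] e] by blast
      moreover obtain u i v j where "x = (u, i)" "y = (v, j)" by (meson surj_pair)
      ultimately show ?thesis unfolding R'_def V'_def by auto
    qed
    have deg: "f u = 2 * m u u + (\<Sum>v\<in>V - {u}. m u v)" if u: "u \<in> V" for u
    proof -
      define B where "B = {u} \<times> (UNIV :: nat set)"
      have split: "\<Union>((\<lambda>e. e \<inter> B) ` M) = {u} \<times> {..<f u}"
        using perfect u unfolding B_def V'_def by fastforce
      have "f u = card ({u} \<times> {..<f u})" by simp
      also have "\<dots> = (\<Sum>e\<in>M. card (e \<inter> B))"
        unfolding split[symmetric]
        using disjM edge finM by (intro card_UN_disjoint) (fastforce simp: pairwise_def)+
      also have "\<dots> = (\<Sum>e\<in>\<Union>(N u ` V). card (e \<inter> B))"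
      proof (rule sum.mono_neutral_right[OF finM])
        show "\<Union>(N u ` V) \<subseteq> M" unfolding N_def by blast
        show "\<forall>e\<in>M - \<Union>(N u ` V). card (e \<inter> B) = 0"
        proof
          fix e assume e: "e \<in> M - \<Union>(N u ` V)"
          then obtain a i b j where ab: "e = {(a, i), (b, j)}" "a \<in> V" "b \<in> V" using edge[of e] by auto
          have "a \<noteq> u" "b \<noteq> u"
            using e ab unfolding N_def by (auto simp: insert_commute)
          then show "card (e \<inter> B) = 0" unfolding ab B_def by auto
        qed
      qed
      also have "\<dots> = (\<Sum>v\<in>V. \<Sum>e\<in>N u v. card (e \<inter> B))"
      proof (rule sum.UNION_disjoint[OF V])
        show "\<forall>v\<in>V. finite (N u v)" unfolding N_def using finM by simp
        show "\<forall>v\<in>V. \<forall>w\<in>V. v \<noteq> w \<longrightarrow> N u v \<inter> N u w = {}"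
          unfolding N_def by (auto simp: doubleton_eq_iff)
      qed
      also have "\<dots> = (\<Sum>v\<in>V. (if v = u then 2 else 1) * m u v)"
      proof (rule sum.cong[OF refl])
        fix v assume "v \<in> V"
        have "card (e \<inter> B) = (if v = u then 2 else 1)" if eN: "e \<in> N u v" for e
        proof -
          obtain i j where e: "e = {(u, i), (v, j)}" "e \<in> M" using eN unfolding N_def by blast
          then have "(u, i) \<noteq> (v, j)" using edge[of e] by auto
          moreover have "e \<inter> B = (if v = u then {(u, i), (v, j)} else {(u, i)})"
            unfolding e B_def by auto
          ultimately show ?thesis by auto
        qed
        then show "(\<Sum>e\<in>N u v. card (e \<inter> B)) = (if v = u then 2 else 1) * m u v"
          by (simp add: m_def)
      qed
      also have "\<dots> = 2 * m u u + (\<Sum>v\<in>V - {u}. m u v)"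
        using V u by (subst sum.remove[of _ u]) (auto intro!: sum.cong)
      finally show ?thesis .
    qed
    have "card {v. (u, v) \<in> E} \<le> f u \<and> (even (card {v. (u, v) \<in> E}) \<longleftrightarrow> even (f u))" if u: "u \<in> V" for u
    proof -
      have eq: "{v. (u, v) \<in> E} = {v \<in> V - {u}. odd (m u v)}" using u unfolding E_def by auto
      have "card {v \<in> V - {u}. odd (m u v)} = (\<Sum>v | v \<in> V - {u} \<and> odd (m u v). 1)" by simp
      also have "\<dots> \<le> (\<Sum>v | v \<in> V - {u} \<and> odd (m u v). m u v)"
        by (rule sum_mono) (auto elim: oddE)
      also have "\<dots> \<le> (\<Sum>v\<in>V - {u}. m u v)" using V by (intro sum_mono2) auto
      finally have "card {v. (u, v) \<in> E} \<le> f u" using deg[OF u] eq by simp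
      moreover have "even (card {v. (u, v) \<in> E}) \<longleftrightarrow> even (f u)"
        unfolding eq deg[OF u] using V by (simp add: even_sum_iff)
      ultimately show ?thesis by simp
    qed
    moreover have "E \<subseteq> R \<inter> V \<times> V"
    proof
      fix p assume "p \<in> E"
      then obtain u v where p: "p = (u, v)" "u \<in> V" "v \<in> V" "u \<noteq> v" "odd (m u v)" unfolding E_def by blast
      then have "N u v \<noteq> {}" unfolding m_def by (metis card.empty even_zero)
      then obtain i j where e: "{(u, i), (v, j)} \<in> M" unfolding N_def by blast
      then have "(u, v) \<in> R \<or> (v, u) \<in> R" using edge[OF e] p by (auto simp: doubleton_eq_iff)
      then show "p \<in> R \<inter> V \<times> V" using p R by (auto dest: symD)
    qed
    moreover have "sym E" unfolding E_def sym_def m_def using N_sym by auto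
    moreover have "irrefl E" unfolding E_def irrefl_def by auto
    ultimately show ?thesis by blast
  next
    case 2
    define S where "S = {v \<in> V. {v} \<times> {..<f v} \<subseteq> U}"
    define Q where "Q = (`) fst ` P"
    have PC: "disjoint P" "{} \<notin> P" "\<Union>P \<subseteq> V' - U"
      and Pc: "\<And>C x y. C \<in> P \<Longrightarrow> x \<in> C \<Longrightarrow> y \<in> V' - U \<Longrightarrow> (x, y) \<in> R' \<Longrightarrow> y \<in> C"
      using P unfolding closed_parts_def by auto
    have disjQ: "fst ` C \<inter> fst ` D = {}" if "C \<in> P" "D \<in> P" "C \<noteq> D" for C D
    proof (rule ccontr)
      assume "fst ` C \<inter> fst ` D \<noteq> {}"
      then obtain u i j where *: "(u, i) \<in> C" "(u, j) \<in> D" by force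
      have "(u, j) \<in> V' - U" using * that PC(3) by blast
      then have "(u, j) \<in> C" using Pc[OF that(1) *(1)] unfolding R'_def by blast
      then show False using * that PC(1) unfolding disjoint_def by blast
    qed
    have "inj_on ((`) fst) P"
    proof (rule inj_onI, rule ccontr)
      fix C D assume CD: "C \<in> P" "D \<in> P" "fst ` C = fst ` D" "C \<noteq> D"
      then have "fst ` C = {}" using disjQ[of C D] by simp
      then show False using CD(1) PC(2) by simp
    qed
    then have cardQ: "card Q = card P" unfolding Q_def by (rule card_image)
    have SU: "Sigma S (\<lambda>v. {..<f v}) \<subseteq> U" unfolding S_def by auto
    have "sum f S = card (Sigma S (\<lambda>v. {..<f v}))"
      using V unfolding S_def by simp
    also have "\<dots> \<le> card U" using SU U V'fin by (meson card_mono finite_subset)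
    finally have "sum f S + 2 \<le> card Q" using 2 cardQ by simp
    moreover have "closed_parts R V S Q"
      unfolding closed_parts_def
    proof (intro conjI ballI impI)
      show "disjoint Q" unfolding Q_def disjoint_def using disjQ by auto
      show "{} \<notin> Q" using PC(2) unfolding Q_def by auto
      show "\<Union>Q \<subseteq> V - S"
      proof
        fix u assume "u \<in> \<Union>Q"
        then obtain C i where C: "C \<in> P" "(u, i) \<in> C" unfolding Q_def by force
        then have "(u, i) \<in> V' - U" using PC(3) by blast
        then show "u \<in> V - S" unfolding V'_def S_def by auto
      qed
      fix A u v assume A: "A \<in> Q" "u \<in> A" "v \<in> V - S" "(u, v) \<in> R"
      obtain C i where C: "C \<in> P" "A = fst ` C" "(u, i) \<in> C" using A unfolding Q_def by force
      obtain j where "(v, j) \<in> V' - U" using A(3) unfolding S_def V'_def by auto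
      then have "(v, j) \<in> C" using Pc[OF C(1,3)] A(4) unfolding R'_def by blast
      then show "v \<in> A" unfolding C(2) by force
    qed
    moreover have "S \<subseteq> V" unfolding S_def by auto
    ultimately show ?thesis by blast
  qed
qed

lemma connected_closed_subset:
  assumes "pair_graph G" "connected (with_proj G)"
    and C: "C \<subseteq> pverts G" "C \<noteq> {}" "\<And>u v. u \<in> C \<Longrightarrow> (u, v) \<in> parcs G \<Longrightarrow> v \<in> C"
  shows "C = pverts G"
proof -
  have sym: "sym (parcs G)" using assms(1) by (simp add: pair_graph_iff)
  have arcs: "parcs (mk_symmetric (with_proj G)) = parcs G"
    using sym by (auto simp: parcs_mk_symmetric sym_def)
  obtain u where u: "u \<in> C" using C by blast
  have "v \<in> C" if v: "v \<in> pverts G" for v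
  proof -
    have "reachable (with_proj (mk_symmetric (with_proj G))) u v"
      using assms(2) u v C(1) unfolding connected_def strongly_connected_def by auto
    then have "(u, v) \<in> rtrancl_on (pverts G) (parcs G)"
      using arcs unfolding reachable_def by simp
    then show ?thesis
      by (induction rule: rtrancl_on_induct) (use u C in auto)
  qed
  then show ?thesis using C(1) by blast
qed

text \<open>
  The capacities \<open>k\<close> on \<open>W\<close> and \<open>k + 1\<close> elsewhere have the required parities and an even sum. Each
  capacity is at least \<open>k\<close>, which gives the factor \<open>k\<close> in the second alternative; there \<open>S\<close> is
  nonempty, because a connected graph cannot have two disjoint closed parts.
\<close>

lemma parity_factor_or_closed_parts:
  assumes G: "pair_graph G" "connected (with_proj G)" and k: "odd k"
    and W: "W \<subseteq> pverts G" "even (card W)"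
  shows "(\<exists>F. pair_graph F \<and> spanning (with_proj F) (with_proj G) \<and>
            (\<forall>u\<in>W. out_degree (with_proj F) u \<in> {d. odd d \<and> d \<le> k}) \<and>
            (\<forall>v\<in>pverts G - W. out_degree (with_proj F) v \<in> {d. even d \<and> d \<le> k + 1}))
       \<or> (\<exists>S P. S \<noteq> {} \<and> S \<subseteq> pverts G \<and> closed_parts (parcs G) (pverts G) S P \<and> k * card S + 2 \<le> card P)"
proof -
  define f where "f v = (if v \<in> W then k else k + 1)" for v
  have fin: "finite (pverts G)" and sym: "sym (parcs G)" and wf: "parcs G \<subseteq> pverts G \<times> pverts G"
    using G(1) by (simp_all add: pair_graph_iff)
  have "sum f (pverts G) = sum f W + sum f (pverts G - W)"
    using fin W(1) by (metis add.commute sum.subset_diff)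
  also have "\<dots> = card W * k + card (pverts G - W) * (k + 1)"
    by (simp add: f_def)
  finally have "even (sum f (pverts G))" using k W(2) by simp
  from parity_subgraph_or_closed_parts[OF fin sym this]
  show ?thesis
  proof (elim disjE exE conjE)
    fix E assume E: "E \<subseteq> parcs G \<inter> pverts G \<times> pverts G" "sym E" "irrefl E"
      and deg: "\<forall>u\<in>pverts G. card {v. (u, v) \<in> E} \<le> f u \<and> (even (card {v. (u, v) \<in> E}) \<longleftrightarrow> even (f u))"
    define F where "F = \<lparr> pverts = pverts G, parcs = E \<rparr>"
    have F: "pair_graph F" unfolding F_def pair_graph_iff using fin E by auto
    have "out_degree (with_proj F) u = card {v. (u, v) \<in> E}" for u
    proof -
      have "out_arcs (with_proj F) u = Pair u ` {v. (u, v) \<in> E}"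
        unfolding out_arcs_def F_def by auto
      then show ?thesis unfolding out_degree_def by (simp add: card_image inj_on_def)
    qed
    moreover have "spanning (with_proj F) (with_proj G)"
      using F G(1) E unfolding spanning_def subgraph_def compatible_def wf_digraph_wp_iff
      by (auto simp: F_def pair_graph_def pair_digraph_def pair_fin_digraph_def)
    moreover have "\<forall>u\<in>W. card {v. (u, v) \<in> E} \<in> {d. odd d \<and> d \<le> k}"
    proof
      fix u assume "u \<in> W"
      then show "card {v. (u, v) \<in> E} \<in> {d. odd d \<and> d \<le> k}"
        using bspec[OF deg, of u] W(1) k by (auto simp: f_def)
    qed
    moreover have "\<forall>u\<in>pverts G - W. card {v. (u, v) \<in> E} \<in> {d. even d \<and> d \<le> k + 1}"
    proof
      fix u assume "u \<in> pverts G - W"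
      then show "card {v. (u, v) \<in> E} \<in> {d. even d \<and> d \<le> k + 1}"
        using bspec[OF deg, of u] k by (simp add: f_def)
    qed
    ultimately have "pair_graph F \<and> spanning (with_proj F) (with_proj G) \<and>
            (\<forall>u\<in>W. out_degree (with_proj F) u \<in> {d. odd d \<and> d \<le> k}) \<and>
            (\<forall>v\<in>pverts G - W. out_degree (with_proj F) v \<in> {d. even d \<and> d \<le> k + 1})"
      using F by presburger
    then show ?thesis by (intro disjI1 exI)
  next
    fix S P assume S: "S \<subseteq> pverts G" and P: "closed_parts (parcs G) (pverts G) S P"
      and le: "sum f S + 2 \<le> card P"
    have "k * card S = (\<Sum>v\<in>S. k)" by simp
    also have "\<dots> \<le> sum f S" by (rule sum_mono) (simp add: f_def)
    finally have "k * card S + 2 \<le> card P" using le by simp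
    moreover have "S \<noteq> {}"
    proof
      assume "S = {}"
      have "C = pverts G" if C: "C \<in> P" for C
      proof (rule connected_closed_subset[OF G])
        have "\<Union>P \<subseteq> pverts G" "{} \<notin> P"
          and closed: "\<forall>u\<in>C. \<forall>v\<in>pverts G. (u, v) \<in> parcs G \<longrightarrow> v \<in> C"
          using P C unfolding closed_parts_def \<open>S = {}\<close> by simp_all
        then show "C \<subseteq> pverts G" "C \<noteq> {}" using C by auto
        show "v \<in> C" if "u \<in> C" "(u, v) \<in> parcs G" for u v
          using closed that wf by blast
      qed
      then have "P \<subseteq> {pverts G}" by blast
      then have "card P \<le> 1" using card_mono[of "{pverts G}" P] by simp
      then show False using le by simp
    qed
    ultimately show ?thesis using S P by blast
  qed
qed

section \<open>Eigenvalues and positive test vectors\<close>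

definition adj_apply :: "'a pair_pre_digraph \<Rightarrow> ('a \<Rightarrow> real) \<Rightarrow> 'a \<Rightarrow> real" where
  "adj_apply G f u = (\<Sum>v\<in>pverts G. (if (u, v) \<in> parcs G then 1 else 0) * f v)"

text \<open>
  An eigenvector is a function on the vertices, so no ordering of the vertices is involved.
\<close>

definition graph_eigenvalue :: "'a pair_pre_digraph \<Rightarrow> real \<Rightarrow> bool" where
  "graph_eigenvalue G x \<longleftrightarrow>
     (\<exists>f. (\<exists>v\<in>pverts G. f v \<noteq> 0) \<and> (\<forall>u\<in>pverts G. adj_apply G f u = x * f u))"

text \<open>
  A complex eigenvalue exists by the fundamental theorem of algebra. It is real because the
  sesquilinear form of a real symmetric matrix takes real values on the diagonal, and then the real or
  the imaginary part of its eigenvector is a real eigenvector.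
\<close>

lemma symmetric_real_matrix_eigenvalue_exists:
  fixes A :: "real mat"
  assumes A: "A \<in> carrier_mat n n" and n: "n > 0"
    and sym: "\<And>i j. i < n \<Longrightarrow> j < n \<Longrightarrow> A $$ (i, j) = A $$ (j, i)"
  shows "\<exists>x. eigenvalue A x"
proof -
  define B where "B = map_mat complex_of_real A"
  have B: "B \<in> carrier_mat n n" using A by (simp add: B_def)
  from spectrum_non_empty[OF B n] obtain z where "eigenvalue B z" unfolding spectrum_def by auto
  then obtain w where w: "eigenvector B w z" unfolding eigenvalue_def by blast
  have dw: "dim_vec w = n" and w0: "w \<noteq> 0\<^sub>v n" and Bw: "B *\<^sub>v w = z \<cdot>\<^sub>v w"
    using w B unfolding eigenvector_def by auto
  have row: "(\<Sum>j<n. of_real (A $$ (i, j)) * w $ j) = z * w $ i" if "i < n" for i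
  proof -
    have "(B *\<^sub>v w) $ i = (\<Sum>j<n. of_real (A $$ (i, j)) * w $ j)"
      using that A dw by (auto simp: B_def scalar_prod_def atLeast0LessThan)
    then show ?thesis using Bw that dw by simp
  qed
  define N where "N = (\<Sum>i<n. (cmod (w $ i))\<^sup>2)"
  have "\<exists>i<n. w $ i \<noteq> 0"
  proof (rule ccontr)
    assume "\<not> ?thesis"
    then have "w = 0\<^sub>v n" using dw by (intro eq_vecI) auto
    with w0 show False by simp
  qed
  then obtain i0 where i0: "i0 < n" "w $ i0 \<noteq> 0" by blast
  have "0 < (cmod (w $ i0))\<^sup>2" using i0 by simp
  also have "\<dots> \<le> N" unfolding N_def using i0 by (intro member_le_sum) auto
  finally have Npos: "N > 0" .
  define q where "q = (\<Sum>i<n. \<Sum>j<n. of_real (A $$ (i, j)) * (cnj (w $ i) * w $ j))"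
  have qN: "q = z * of_real N"
  proof -
    have "q = (\<Sum>i<n. cnj (w $ i) * (\<Sum>j<n. of_real (A $$ (i, j)) * w $ j))"
      unfolding q_def by (simp add: sum_distrib_left mult_ac)
    also have "\<dots> = (\<Sum>i<n. z * of_real ((cmod (w $ i))\<^sup>2))"
    proof (rule sum.cong[OF refl])
      fix i assume "i \<in> {..<n}"
      then have "cnj (w $ i) * (\<Sum>j<n. of_real (A $$ (i, j)) * w $ j) = z * (w $ i * cnj (w $ i))"
        using row[of i] by (simp add: mult_ac)
      also have "\<dots> = z * of_real ((cmod (w $ i))\<^sup>2)" by (simp only: complex_norm_square)
      finally show "cnj (w $ i) * (\<Sum>j<n. of_real (A $$ (i, j)) * w $ j) = z * of_real ((cmod (w $ i))\<^sup>2)" .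
    qed
    finally show ?thesis by (simp add: N_def sum_distrib_left)
  qed
  have "cnj q = (\<Sum>i<n. \<Sum>j<n. of_real (A $$ (i, j)) * (w $ i * cnj (w $ j)))"
    unfolding q_def by simp
  also have "\<dots> = (\<Sum>j<n. \<Sum>i<n. of_real (A $$ (i, j)) * (w $ i * cnj (w $ j)))"
    by (rule sum.swap)
  also have "\<dots> = q"
    unfolding q_def using sym by (intro sum.cong refl) (auto simp: mult_ac)
  finally have "cnj q = q" .
  then have "cnj z * of_real N = z * of_real N" unfolding qN by simp
  then have "cnj z = z" using Npos by simp
  then have z: "z = of_real (Re z)" by (simp add: complex_eq_iff)
  have re: "eigenvalue A (Re z)" if g: "g = Re \<or> g = Im" and nz: "g (w $ i0) \<noteq> 0" for g
  proof -
    define v where "v = vec n (\<lambda>i. g (w $ i))"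
    have "A *\<^sub>v v = Re z \<cdot>\<^sub>v v"
    proof (rule eq_vecI)
      fix i assume "i < dim_vec (Re z \<cdot>\<^sub>v v)"
      then have i: "i < n" by (simp add: v_def)
      have "(A *\<^sub>v v) $ i = (\<Sum>j<n. A $$ (i, j) * g (w $ j))"
        using i A by (auto simp: v_def scalar_prod_def atLeast0LessThan)
      also have "\<dots> = g (\<Sum>j<n. of_real (A $$ (i, j)) * w $ j)"
        using g by auto
      also have "\<dots> = g (of_real (Re z) * w $ i)" using row[OF i] z by simp
      also have "\<dots> = (Re z \<cdot>\<^sub>v v) $ i" using g i by (auto simp: v_def)
      finally show "(A *\<^sub>v v) $ i = (Re z \<cdot>\<^sub>v v) $ i" .
    qed (use A in \<open>simp add: v_def\<close>)
    moreover have "v \<noteq> 0\<^sub>v n" using nz i0 unfolding v_def by (metis index_vec index_zero_vec(1))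
    ultimately show ?thesis
      using A unfolding eigenvalue_def eigenvector_def by (intro exI[of _ v]) (auto simp: v_def)
  qed
  from i0 have "Re (w $ i0) \<noteq> 0 \<or> Im (w $ i0) \<noteq> 0" by (simp add: complex_eq_iff)
  then show ?thesis using re by blast
qed

lemma spectrum_adjacency_matrix:
  assumes "distinct vs" "set vs = pverts G"
  shows "spectrum (adjacency_matrix vs G) = {x. graph_eigenvalue G x}"
  unfolding spectrum_def graph_eigenvalue_def adj_apply_def
  using eigenvalue_adjacency_matrix_iff[OF assms] by auto

lemma
  assumes G: "pair_graph G"
  shows eigenvalue_le_graph_spectral_radius: "graph_eigenvalue G x \<Longrightarrow> x \<le> graph_spectral_radius G"
    and graph_spectral_radius_eigenvalue:
      "pverts G \<noteq> {} \<Longrightarrow> graph_eigenvalue G (graph_spectral_radius G)"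
proof -
  have fin: "finite (pverts G)" and sym: "sym (parcs G)"
    using G by (simp_all add: pair_graph_iff)
  obtain vs where vs: "set vs = pverts G" "distinct vs" using finite_distinct_list[OF fin] by blast
  define A where "A = adjacency_matrix vs G"
  have A: "A \<in> carrier_mat (length vs) (length vs)" unfolding A_def adjacency_matrix_def by simp
  have rho: "graph_spectral_radius G = Max (spectrum A)"
    and spec: "spectrum A = {x. graph_eigenvalue G x}"
    using graph_spectral_radius_eq[OF vs(2,1)] spectrum_adjacency_matrix[OF vs(2,1)]
    unfolding A_def by simp_all
  have finS: "finite (spectrum A)" using card_finite_spectrum[OF A] by simp
  show "x \<le> graph_spectral_radius G" if "graph_eigenvalue G x"
    unfolding rho using finS that by (intro Max_ge) (auto simp: spec)
  show "graph_eigenvalue G (graph_spectral_radius G)" if "pverts G \<noteq> {}"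
  proof -
    have "length vs > 0" using vs that by auto
    moreover have "A $$ (i, j) = A $$ (j, i)" if "i < length vs" "j < length vs" for i j
      using that sym unfolding A_def adjacency_matrix_def by (auto dest: symD)
    ultimately have "spectrum A \<noteq> {}"
      using symmetric_real_matrix_eigenvalue_exists[OF A] unfolding spectrum_def by blast
    then have "Max (spectrum A) \<in> spectrum A" using finS by (rule Max_in[rotated])
    then show ?thesis unfolding rho spec by simp
  qed
qed

lemma adj_apply_swap:
  assumes "pair_graph G"
  shows "(\<Sum>u\<in>pverts G. adj_apply G f u * g u) = (\<Sum>u\<in>pverts G. f u * adj_apply G g u)"
proof -
  have sym: "(u, v) \<in> parcs G \<longleftrightarrow> (v, u) \<in> parcs G" for u v
    using assms by (auto simp: pair_graph_iff dest: symD)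
  have "(\<Sum>u\<in>pverts G. adj_apply G f u * g u) =
      (\<Sum>u\<in>pverts G. \<Sum>v\<in>pverts G. (if (u, v) \<in> parcs G then 1 else 0) * f v * g u)"
    unfolding adj_apply_def by (simp add: sum_distrib_right)
  also have "\<dots> = (\<Sum>v\<in>pverts G. \<Sum>u\<in>pverts G. (if (u, v) \<in> parcs G then 1 else 0) * f v * g u)"
    by (rule sum.swap)
  also have "\<dots> = (\<Sum>u\<in>pverts G. f u * adj_apply G g u)"
    unfolding adj_apply_def sum_distrib_left by (intro sum.cong refl) (simp add: sym[of _ u for u])
  finally show ?thesis .
qed

text \<open>
  If \<open>f\<close> is an eigenvector for \<open>x\<close> and \<open>g = \<bar>f\<bar>\<close>, then \<open>x g \<le> A g\<close> by the triangle inequality, and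
  pairing with \<open>y\<close> gives \<open>x \<langle>g, y\<rangle> \<le> \<langle>A g, y\<rangle> = \<langle>g, A y\<rangle> \<le> r \<langle>g, y\<rangle>\<close> by symmetry of \<open>A\<close>. For
  \<open>x = r\<close> all these inequalities are equalities. The first one then says \<open>A g = r g\<close>, so the zero set of
  \<open>g\<close> is closed under adjacency and therefore empty in a connected graph; the last one says \<open>A y = r y\<close>
  wherever \<open>g\<close> is positive.
\<close>

lemma
  assumes G: "pair_graph G"
    and y: "\<And>u. u \<in> pverts G \<Longrightarrow> y u > 0"
    and super: "\<And>u. u \<in> pverts G \<Longrightarrow> adj_apply G y u \<le> r * y u"
    and x: "graph_eigenvalue G x"
  shows eigenvalue_le_of_supersolution: "x \<le> r"
    and supersolution_tight:
      "connected (with_proj G) \<Longrightarrow> x = r \<Longrightarrow> u \<in> pverts G \<Longrightarrow> adj_apply G y u = r * y u"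
proof -
  have fin: "finite (pverts G)" and wf: "parcs G \<subseteq> pverts G \<times> pverts G"
    using G by (simp_all add: pair_graph_iff)
  obtain f where f0: "\<exists>v\<in>pverts G. f v \<noteq> 0" and f: "\<And>u. u \<in> pverts G \<Longrightarrow> adj_apply G f u = x * f u"
    using x unfolding graph_eigenvalue_def by blast
  define g where "g u = \<bar>f u\<bar>" for u
  have g0: "g u \<ge> 0" for u by (simp add: g_def)
  have sub: "x * g u \<le> adj_apply G g u" if "u \<in> pverts G" for u
  proof -
    have "x * g u \<le> \<bar>x * f u\<bar>" by (simp add: g_def abs_mult mult_right_mono)
    also have "\<dots> = \<bar>adj_apply G f u\<bar>" using f[OF that] by simp
    also have "\<dots> \<le> adj_apply G g u"
      unfolding adj_apply_def g_def
      by (rule order_trans[OF sum_abs]) (rule sum_mono, simp)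
    finally show ?thesis .
  qed
  define T where "T = (\<Sum>u\<in>pverts G. g u * y u)"
  have "T > 0"
  proof -
    obtain v where v: "v \<in> pverts G" "f v \<noteq> 0" using f0 by blast
    have "0 < g v * y v" using v y by (simp add: g_def)
    also have "\<dots> \<le> T" unfolding T_def
      using v fin g0 y by (intro member_le_sum) (auto simp: less_imp_le)
    finally show ?thesis .
  qed
  have lo: "x * T \<le> (\<Sum>u\<in>pverts G. adj_apply G g u * y u)"
  proof -
    have "x * T = (\<Sum>u\<in>pverts G. (x * g u) * y u)" by (simp add: T_def sum_distrib_left mult_ac)
    also have "\<dots> \<le> (\<Sum>u\<in>pverts G. adj_apply G g u * y u)"
      using sub y by (intro sum_mono mult_right_mono) (auto simp: less_imp_le)
    finally show ?thesis .
  qed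
  have hi: "(\<Sum>u\<in>pverts G. g u * adj_apply G y u) \<le> r * T"
  proof -
    have "(\<Sum>u\<in>pverts G. g u * adj_apply G y u) \<le> (\<Sum>u\<in>pverts G. g u * (r * y u))"
      using super g0 by (intro sum_mono mult_left_mono) auto
    also have "\<dots> = r * T" by (simp add: T_def sum_distrib_left mult_ac)
    finally show ?thesis .
  qed
  have "x * T \<le> r * T" using lo hi adj_apply_swap[OF G, of g y] by simp
  then show "x \<le> r" using \<open>T > 0\<close> by simp
  show "adj_apply G y u = r * y u" if conn: "connected (with_proj G)" and xr: "x = r" and u: "u \<in> pverts G"
  proof -
    have eq1: "(\<Sum>u\<in>pverts G. adj_apply G g u * y u) = r * T"
      and eq2: "(\<Sum>u\<in>pverts G. g u * adj_apply G y u) = r * T"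
      using lo[unfolded xr] hi adj_apply_swap[OF G, of g y] by linarith+
    have "(\<Sum>u\<in>pverts G. (adj_apply G g u - r * g u) * y u) = 0"
      using eq1 unfolding left_diff_distrib sum_subtractf by (simp add: T_def sum_distrib_left mult.assoc)
    moreover have "(adj_apply G g v - r * g v) * y v \<ge> 0" if "v \<in> pverts G" for v
      using sub[OF that] y[OF that] xr by simp
    ultimately have "(adj_apply G g v - r * g v) * y v = 0" if "v \<in> pverts G" for v
      using sum_nonneg_eq_0_iff[OF fin] that by (metis (no_types, lifting))
    then have gev: "adj_apply G g v = r * g v" if "v \<in> pverts G" for v
      using y that by fastforce
    have gpos: "g v \<noteq> 0" if v: "v \<in> pverts G" for v
    proof
      assume "g v = 0"
      define Z where "Z = {w \<in> pverts G. g w = 0}"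
      have "Z = pverts G"
      proof (rule connected_closed_subset[OF G conn])
        show "Z \<subseteq> pverts G" "Z \<noteq> {}" using v \<open>g v = 0\<close> unfolding Z_def by auto
        show "b \<in> Z" if "a \<in> Z" "(a, b) \<in> parcs G" for a b
        proof -
          have a: "a \<in> pverts G" "g a = 0" using that unfolding Z_def by auto
          have b: "b \<in> pverts G" using that wf by blast
          have "g b \<le> adj_apply G g a"
            unfolding adj_apply_def
            using member_le_sum[OF b, of "\<lambda>v. (if (a, v) \<in> parcs G then 1 else 0) * g v"] fin g0 that
            by simp
          also have "\<dots> = 0" using gev[OF a(1)] a(2) by simp
          finally show ?thesis using g0[of b] b unfolding Z_def by simp
        qed
      qed
      then show False using f0 unfolding Z_def g_def by auto
    qed
    have "(\<Sum>u\<in>pverts G. g u * (r * y u - adj_apply G y u)) = 0"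
      using eq2 by (simp add: T_def sum_subtractf right_diff_distrib sum_distrib_left mult_ac)
    moreover have "g v * (r * y v - adj_apply G y v) \<ge> 0" if "v \<in> pverts G" for v
      using super[OF that] g0 by simp
    ultimately have "g u * (r * y u - adj_apply G y u) = 0"
      using sum_nonneg_eq_0_iff[OF fin] u by (metis (no_types, lifting))
    then show ?thesis using gpos[OF u] by simp
  qed
qed

section \<open>The spectral radius of the extremal graph\<close>

text \<open>
  This is the characteristic equation of the partition of the extremal graph into its hub, the clique
  of order \<open>L\<close>, the \<open>k\<close> edges and the isolated vertex. At \<open>L\<close> its right-hand side is larger
  than \<open>L\<close>, because the last summand alone equals \<open>L\<close>; at \<open>L + 2 * k + 2\<close> it is smaller than its
  argument.
\<close>

lemma extremal_root_exists:
  fixes k L :: nat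
  assumes "L \<ge> 2"
  shows "\<exists>r > real L. r = 1 / r + 2 * real k / (r - 1) + real L / (r + 1 - real L)"
proof -
  define h where "h r = 1 / r + 2 * real k / (r - 1) + real L / (r + 1 - real L)" for r
  define n where "n = real L + 2 * real k + 2"
  have hL: "h (real L) > real L"
  proof -
    have "1 / real L > 0" "2 * real k / (real L - 1) \<ge> 0" using assms by simp_all
    then have "0 < 1 / real L + 2 * real k / (real L - 1)" by (rule add_pos_nonneg)
    then show ?thesis by (simp add: h_def)
  qed
  have "\<exists>r. real L \<le> r \<and> r \<le> n \<and> r - h r = 0"
  proof (rule IVT')
    show "real L - h (real L) \<le> 0" using hL by simp
    have "1 / n \<le> 1" "2 * real k / (n - 1) \<le> 2 * real k" "real L / (n + 1 - real L) \<le> real L"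
      using assms by (simp_all add: n_def divide_le_eq mult_left_le_one_le mult_le_cancel_left1)
    then have "h n \<le> 1 + 2 * real k + real L" unfolding h_def by linarith
    also have "\<dots> \<le> n" by (simp add: n_def)
    finally have "h n \<le> n" .
    then show "0 \<le> n - h n" by simp
    show "real L \<le> n" by (simp add: n_def)
    show "continuous_on {real L..n} (\<lambda>r. r - h r)"
      unfolding h_def using assms by (intro continuous_intros) auto
  qed
  then obtain r where r: "real L \<le> r" "r = h r" by auto
  have "real L \<noteq> r" using r hL by auto
  with r show ?thesis unfolding h_def by (intro exI[of _ r]) auto
qed

text \<open>
  The eigenvector is 1 on the hub and constant on each of the other three classes. Its value on a
  clique of order \<open>c\<close> is forced to be \<open>1 / (r + 1 - c)\<close>, and the equation at the hub is the one for \<open>r\<close>.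
\<close>

lemma extremal_graph_eigenvalue:
  fixes k L :: nat
  assumes "L \<ge> 2" and r: "r > real L" "r = 1 / r + 2 * real k / (r - 1) + real L / (r + 1 - real L)"
  shows "graph_eigenvalue (extremal_graph (L + 2 * k + 2) k) r"
proof -
  let ?G = "extremal_graph (L + 2 * k + 2) k"
  define a b c where "a = 1 / (r + 1 - real L)" and "b = 1 / (r - 1)" and "c = 1 / r"
  have abc: "1 + (real L - 1) * a = r * a" "1 + b = r * b" "1 = r * c"
    using assms(1) r(1) by (simp_all add: a_def b_def c_def field_simps)
  have hub_eq: "real L * a + 2 * real k * b + c = r"
    using r(2) by (simp add: a_def b_def c_def)
  define f :: "nat + ((nat + nat \<times> nat) + nat) \<Rightarrow> real" where
    "f = case_sum (\<lambda>_. 1) (case_sum (case_sum (\<lambda>_. a) (\<lambda>_. b)) (\<lambda>_. c))"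
  have verts: "pverts ?G = {..<1} <+> (({..<L} <+> {..<k} \<times> {..<2}) <+> {..<1})"
    by (simp add: extremal_graph_def graph_join_def disjoint_union_def complete_graph_def copies_def)
  have sum_eq: "(\<Sum>v\<in>pverts ?G. g v) = g (Inl 0) + ((\<Sum>i<L. g (Inr (Inl (Inl i)))) +
      (\<Sum>j<k. \<Sum>b<2. g (Inr (Inl (Inr (j, b))))) + g (Inr (Inr 0)))" for g :: "_ \<Rightarrow> real"
    unfolding verts by (simp add: sum.Plus sum.cartesian_product lessThan_Suc)
  have arcs: "parcs ?G = parcs (graph_join (complete_graph 1) (disjoint_union
      (disjoint_union (complete_graph L) (copies k (complete_graph 2))) (complete_graph 1)))"
    by (simp add: extremal_graph_def)
  note defs = graph_join_def disjoint_union_def complete_graph_def copies_def Plus_def image_iff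
  have "adj_apply ?G f u = r * f u" if u: "u \<in> pverts ?G" for u
  proof -
    from u consider (hub) "u = Inl 0" | (big) i where "u = Inr (Inl (Inl i))" "i < L"
      | (pair) j d where "u = Inr (Inl (Inr (j, d)))" "j < k" "d < 2" | (single) "u = Inr (Inr 0)"
      unfolding verts by auto
    then show ?thesis
    proof cases
      case hub
      show ?thesis
        unfolding adj_apply_def sum_eq arcs hub
        using hub_eq by (simp add: f_def defs cong: sum.cong_simp)
    next
      case big
      have "(\<Sum>j<L. (if i \<noteq> j then 1 else 0) * a) = (\<Sum>j<L. a - (if j = i then a else 0))"
        by (intro sum.cong) auto
      also have "\<dots> = (real L - 1) * a"
        using big(2) by (simp add: sum_subtractf left_diff_distrib)
      finally have sum: "(\<Sum>j<L. (if i \<noteq> j then 1 else 0) * a) = (real L - 1) * a" .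
      have "adj_apply ?G f u = 1 + (\<Sum>j<L. (if i \<noteq> j then 1 else 0) * a)"
        unfolding adj_apply_def sum_eq arcs big(1)
        using big(2) by (simp add: f_def defs cong: sum.cong_simp)
      then show ?thesis using sum abc(1) by (simp add: f_def big(1))
    next
      case pair
      have "(\<Sum>e<2. (if i = j \<and> d \<noteq> e then 1 else 0) * b) = (if i = j then b else 0)" for i
        using pair(3) by (auto simp: numeral_2_eq_2 less_Suc_eq)
      then have sum: "(\<Sum>i<k. \<Sum>e<2. (if i = j \<and> d \<noteq> e then 1 else 0) * b) = b"
        using pair(2) by simp
      have "adj_apply ?G f u = 1 + (\<Sum>i<k. \<Sum>e<2. (if i = j \<and> d \<noteq> e then 1 else 0) * b)"
        unfolding adj_apply_def sum_eq arcs pair(1)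
        using pair(2,3) by (simp add: f_def defs eq_commute[of j] cong: sum.cong_simp)
      then show ?thesis using sum abc(2) by (simp add: f_def pair(1))
    next
      case single
      show ?thesis
        unfolding adj_apply_def sum_eq arcs single
        using abc(3) by (simp add: f_def defs)
    qed
  qed
  moreover have "Inl 0 \<in> pverts ?G" "f (Inl 0) \<noteq> 0" unfolding verts by (auto simp: f_def)
  ultimately show ?thesis unfolding graph_eigenvalue_def by blast
qed

section \<open>Binding number and spectral radius of a graph with closed parts\<close>

text \<open>
  The union of the one-vertex parts is independent and has all its neighbours in \<open>S\<close>, so it is an
  admissible set in the definition of the binding number.
\<close>

lemma binding_singleton_parts:
  assumes G: "pair_graph G" and bind: "r_binding 1 G"
    and S: "S \<subseteq> pverts G" and P: "closed_parts (parcs G) (pverts G) S P"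
  shows "card {C \<in> P. card C = 1} \<le> card S"
proof (cases "{C \<in> P. card C = 1} = {}")
  case True
  show ?thesis unfolding True by simp
next
  case False
  define I where "I = {u. {u} \<in> P}"
  have fin: "finite (pverts G)" and irr: "irrefl (parcs G)"
    using G by (simp_all add: pair_graph_iff)
  have sub: "\<Union>P \<subseteq> pverts G - S"
    and cl: "\<And>C u v. C \<in> P \<Longrightarrow> u \<in> C \<Longrightarrow> v \<in> pverts G - S \<Longrightarrow> (u, v) \<in> parcs G \<Longrightarrow> v \<in> C"
    using P by (simp_all add: closed_parts_def)
  have "{C \<in> P. card C = 1} = (\<lambda>u. {u}) ` I"
    unfolding I_def by (auto simp: card_1_singleton_iff)
  then have cardI: "card {C \<in> P. card C = 1} = card I" and I: "I \<noteq> {}"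
    using False by (simp_all add: card_image)
  have IV: "I \<subseteq> pverts G - S" using sub unfolding I_def by auto
  have N: "neighbourhood G I \<subseteq> S"
  proof
    fix v assume "v \<in> neighbourhood G I"
    then obtain u where u: "{u} \<in> P" "(u, v) \<in> parcs G" "v \<in> pverts G"
      unfolding neighbourhood_def I_def by blast
    show "v \<in> S"
    proof (rule ccontr)
      assume "v \<notin> S"
      then have "v \<in> {u}" using cl[OF u(1), of u v] u by simp
      then show False using u irr by (simp add: irrefl_def)
    qed
  qed
  then have "neighbourhood G I \<noteq> pverts G" using I IV by auto
  then have "binding_number G \<le> real (card (neighbourhood G I)) / real (card I)"
    unfolding binding_number_def
    using I IV binding_number_set_finite_nonempty(1)[OF G] by (intro Min_le) auto
  then have "1 \<le> real (card (neighbourhood G I)) / real (card I)"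
    using bind by (simp add: r_binding_def)
  moreover have "card I > 0" using I IV fin by (meson card_gt_0_iff finite_Diff finite_subset)
  ultimately have "card I \<le> card (neighbourhood G I)" by (simp add: le_divide_eq)
  also have "\<dots> \<le> card S" using N S fin by (meson card_mono finite_subset)
  finally show ?thesis using cardI by simp
qed

text \<open>
  The uncovered vertices form a closed set themselves and can be added to any one part.
\<close>

lemma closed_parts_extend_to_cover:
  assumes V: "finite V" and R: "sym R" and P: "closed_parts R V S P" "P \<noteq> {}"
  shows "\<exists>Q. closed_parts R V S Q \<and> \<Union>Q = V - S \<and> card Q = card P"
proof -
  have disj: "disjoint P" and ne: "{} \<notin> P" and sub: "\<Union>P \<subseteq> V - S"
    and cl: "\<And>C u v. C \<in> P \<Longrightarrow> u \<in> C \<Longrightarrow> v \<in> V - S \<Longrightarrow> (u, v) \<in> R \<Longrightarrow> v \<in> C"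
    using P(1) by (simp_all add: closed_parts_def)
  have finP: "finite P" using sub V by (meson finite_Diff finite_UnionD finite_subset)
  obtain C0 where C0: "C0 \<in> P" using P(2) by blast
  define B where "B = C0 \<union> (V - S - \<Union>P)"
  define Q where "Q = insert B (P - {C0})"
  have C0ne: "C0 \<noteq> {}" using C0 ne by auto
  have dB: "C \<inter> B = {}" if "C \<in> P" "C \<noteq> C0" for C
    using that disj C0 unfolding B_def disjoint_def by blast
  have "B \<notin> P - {C0}"
  proof
    assume "B \<in> P - {C0}"
    then have "B \<inter> B = {}" using dB[of B] by simp
    then show False using C0ne by (simp add: B_def)
  qed
  then have "card Q = card P"
    unfolding Q_def using finP card.remove[OF finP C0] by simp
  moreover have "\<Union>Q = V - S" unfolding Q_def B_def using sub C0 by auto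
  moreover have "closed_parts R V S Q"
    unfolding closed_parts_def
  proof (intro conjI ballI impI)
    show "disjoint Q" using disj dB unfolding Q_def disjoint_def by (auto simp: Int_commute)
    show "{} \<notin> Q" using ne C0ne unfolding Q_def B_def by auto
    show "\<Union>Q \<subseteq> V - S" using \<open>\<Union>Q = V - S\<close> by simp
    fix C u v assume C: "C \<in> Q" "u \<in> C" "v \<in> V - S" "(u, v) \<in> R"
    show "v \<in> C"
    proof (cases "C = B")
      case False
      then have "C \<in> P" using C unfolding Q_def by simp
      then show ?thesis using cl C by blast
    next
      case True
      show ?thesis
      proof (rule ccontr)
        assume v: "v \<notin> C"
        then obtain D where D: "D \<in> P" "v \<in> D" "v \<notin> C0" using C(3) True unfolding B_def by auto
        moreover have "u \<in> V - S" using C(2) True sub C0 unfolding B_def by auto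
        ultimately have "u \<in> D" using cl[of D v u] C(4) R by (simp add: symD)
        then show False using dB[OF D(1)] D C(2) True by auto
      qed
    qed
  qed
  ultimately show ?thesis by blast
qed

text \<open>
  The graph \<open>H\<close> with edge set \<open>J\<close> has all edges that the closed parts permit: \<open>S\<close> and every part are
  cliques, and \<open>S\<close> is joined to all other vertices. The test vector \<open>y\<close> satisfies the eigenvalue equation
  for \<open>H\<close> exactly on the parts, and on \<open>S\<close> the inequality \<open>A y \<le> r y\<close> for \<open>H\<close> is hypothesis \<open>le\<close>. Since \<open>y\<close>
  is positive, each edge of \<open>H\<close> missing in \<open>G\<close> makes the inequality strict somewhere.
\<close>

lemma partition_spectral_bound:
  fixes S :: "'a set" and P :: "'a set set" and r :: real
  assumes G: "pair_graph G"
    and S: "S \<subseteq> pverts G" "S \<noteq> {}"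
    and P: "closed_parts (parcs G) (pverts G) S P" and cover: "\<Union>P = pverts G - S"
    and small: "\<And>C. C \<in> P \<Longrightarrow> real (card C) < r + 1"
    and le: "real (card S) - 1 + (\<Sum>C\<in>P. real (card C) * real (card S) / (r + 1 - real (card C))) \<le> r"
  defines "J \<equiv> {(u, v). u \<in> pverts G \<and> v \<in> pverts G \<and> u \<noteq> v \<and>
                  (u \<in> S \<or> v \<in> S \<or> (\<exists>C\<in>P. u \<in> C \<and> v \<in> C))}"
  shows "graph_spectral_radius G \<le> r"
    and "connected (with_proj G) \<Longrightarrow> graph_spectral_radius G = r \<Longrightarrow>
           parcs G = J \<and> real (card S) - 1 + (\<Sum>C\<in>P. real (card C) * real (card S) / (r + 1 - real (card C))) = r"
proof -
  let ?V = "pverts G"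
  have fin: "finite ?V" and irr: "irrefl (parcs G)" and wf: "parcs G \<subseteq> ?V \<times> ?V"
    using G by (simp_all add: pair_graph_iff)
  have disj: "disjoint P"
    and cl: "\<And>C u v. C \<in> P \<Longrightarrow> u \<in> C \<Longrightarrow> v \<in> ?V - S \<Longrightarrow> (u, v) \<in> parcs G \<Longrightarrow> v \<in> C"
    using P by (simp_all add: closed_parts_def)
  have finP: "finite P" using cover fin by (metis finite_Diff finite_UnionD)
  have finC: "finite C" if "C \<in> P" for C
    using that cover fin by (metis Sup_upper finite_Diff finite_subset)
  have finS: "finite S" using S fin finite_subset by blast
  define s where "s = real (card S)"
  have s0: "s > 0" using S finS by (simp add: s_def card_gt_0_iff)
  define part where "part u = (THE C. C \<in> P \<and> u \<in> C)" for u
  have part: "part u = C" if "C \<in> P" "u \<in> C" for u C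
    unfolding part_def using that disj by (intro the_equality) (auto simp: disjoint_def)
  define y where "y u = (if u \<in> S then 1 else s / (r + 1 - real (card (part u))))" for u
  have yS: "y u = 1" if "u \<in> S" for u using that by (simp add: y_def)
  have notS: "u \<notin> S" if "C \<in> P" "u \<in> C" for u C using that cover by auto
  have yC: "y u = s / (r + 1 - real (card C))" if "C \<in> P" "u \<in> C" for u C
    using that part notS by (simp add: y_def)
  have cases: "u \<in> S \<or> (\<exists>C\<in>P. u \<in> C)" if "u \<in> ?V" for u using that cover by blast
  have ypos: "y u > 0" if "u \<in> ?V" for u
    using cases[OF that]
  proof
    assume "\<exists>C\<in>P. u \<in> C"
    then obtain C where C: "C \<in> P" "u \<in> C" by blast
    then show ?thesis using yC[OF C] small[OF C(1)] s0 by simp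
  qed (simp add: yS)
  define H where "H = \<lparr>pverts = ?V, parcs = J\<rparr>"
  have GJ: "parcs G \<subseteq> J"
  proof
    fix p assume p: "p \<in> parcs G"
    obtain u v where uv: "p = (u, v)" by (meson surj_pair)
    have V: "u \<in> ?V" "v \<in> ?V" and ne: "u \<noteq> v" using p uv wf irr by (auto simp: irrefl_def)
    have "\<exists>C\<in>P. u \<in> C \<and> v \<in> C" if "u \<notin> S" "v \<notin> S"
      using cases[OF V(1)] cl[of _ u v] that V p uv by auto
    then show "p \<in> J" using V ne by (auto simp: J_def uv)
  qed
  have split: "(\<Sum>v\<in>?V. g v) = (\<Sum>v\<in>S. g v) + (\<Sum>C\<in>P. \<Sum>v\<in>C. g v)" for g :: "'a \<Rightarrow> real"
  proof -
    have "(\<Sum>v\<in>?V. g v) = (\<Sum>v\<in>S. g v) + (\<Sum>v\<in>\<Union>P. g v)"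
      unfolding cover using S(1) fin by (metis add.commute sum.subset_diff)
    also have "(\<Sum>v\<in>\<Union>P. g v) = (\<Sum>C\<in>P. \<Sum>v\<in>C. g v)"
      using finC disj by (subst sum.Union_disjoint) (auto simp: disjoint_def)
    finally show ?thesis .
  qed
  have HS: "adj_apply H y u = s - 1 + (\<Sum>C\<in>P. real (card C) * s / (r + 1 - real (card C)))" if u: "u \<in> S" for u
  proof -
    have "(\<Sum>v\<in>S. (if (u, v) \<in> J then 1 else 0) * y v) = (\<Sum>v\<in>S. 1 - (if v = u then 1 else 0))"
      using u S(1) by (intro sum.cong) (auto simp: J_def yS)
    also have "\<dots> = s - 1" using finS u by (simp add: sum_subtractf s_def)
    finally have 1: "(\<Sum>v\<in>S. (if (u, v) \<in> J then 1 else 0) * y v) = s - 1" .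
    have 2: "(\<Sum>v\<in>C. (if (u, v) \<in> J then 1 else 0) * y v) = real (card C) * s / (r + 1 - real (card C))"
      if C: "C \<in> P" for C
    proof -
      have "(\<Sum>v\<in>C. (if (u, v) \<in> J then 1 else 0) * y v) = (\<Sum>v\<in>C. s / (r + 1 - real (card C)))"
      proof (rule sum.cong[OF refl])
        fix v assume v: "v \<in> C"
        then have "(u, v) \<in> J" using u S(1) C cover notS[OF C v] unfolding J_def by auto
        then show "(if (u, v) \<in> J then 1 else 0) * y v = s / (r + 1 - real (card C))"
          using yC[OF C v] by simp
      qed
      then show ?thesis by simp
    qed
    show ?thesis unfolding adj_apply_def H_def by (simp add: split 1 2)
  qed
  have HC: "adj_apply H y u = r * y u" if C: "C \<in> P" "u \<in> C" for u C
  proof -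
    define t where "t = s / (r + 1 - real (card C))"
    have uV: "u \<in> ?V" using C cover by blast
    have "(\<Sum>v\<in>S. (if (u, v) \<in> J then 1 else 0) * y v) = (\<Sum>v\<in>S. 1)"
      using S(1) uV notS[OF C] by (intro sum.cong) (auto simp: J_def yS)
    then have 1: "(\<Sum>v\<in>S. (if (u, v) \<in> J then 1 else 0) * y v) = s" by (simp add: s_def)
    have 2: "(\<Sum>v\<in>D. (if (u, v) \<in> J then 1 else 0) * y v) = (if D = C then (real (card C) - 1) * t else 0)"
      if D: "D \<in> P" for D
    proof (cases "D = C")
      case True
      have "(\<Sum>v\<in>D. (if (u, v) \<in> J then 1 else 0) * y v) = (\<Sum>v\<in>C. t - (if v = u then t else 0))"
        unfolding True
      proof (rule sum.cong[OF refl])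
        fix v assume v: "v \<in> C"
        have "(u, v) \<in> J \<longleftrightarrow> u \<noteq> v" using v C cover unfolding J_def by auto
        then show "(if (u, v) \<in> J then 1 else 0) * y v = t - (if v = u then t else 0)"
          using yC[OF C(1) v] by (auto simp: t_def)
      qed
      also have "\<dots> = (real (card C) - 1) * t"
        using finC[OF C(1)] C(2) by (simp add: sum_subtractf left_diff_distrib)
      finally show ?thesis using True by simp
    next
      case False
      have "(u, v) \<notin> J" if v: "v \<in> D" for v
      proof
        assume "(u, v) \<in> J"
        then obtain E where E: "E \<in> P" "u \<in> E" "v \<in> E"
          using notS[OF C] notS[OF D v] unfolding J_def by auto
        then have "E = C" "E = D" using part C D v by blast+
        then show False using False by simp
      qed
      then show ?thesis using False by simp
    qed
    have "adj_apply H y u = s + (real (card C) - 1) * t"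
      unfolding adj_apply_def H_def using finP C(1) by (simp add: split 1 2)
    also have "\<dots> = r * t" using small[OF C(1)] by (simp add: t_def field_simps)
    finally show ?thesis using yC[OF C] by (simp add: t_def)
  qed
  have Hle: "adj_apply H y u \<le> r * y u" if u: "u \<in> ?V" for u
    using cases[OF u] HS HC yS le by (auto simp: s_def)
  have GH: "adj_apply G y u \<le> adj_apply H y u" for u
    unfolding adj_apply_def H_def using GJ ypos
    by (auto intro!: sum_mono simp: less_imp_le)
  have super: "adj_apply G y u \<le> r * y u" if "u \<in> ?V" for u
    using GH[of u] Hle[OF that] by simp
  have ev: "graph_eigenvalue G (graph_spectral_radius G)"
    using graph_spectral_radius_eigenvalue[OF G] S by auto
  show "graph_spectral_radius G \<le> r"
    by (rule eigenvalue_le_of_supersolution[OF G ypos super ev])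
  show "parcs G = J \<and> real (card S) - 1 + (\<Sum>C\<in>P. real (card C) * real (card S) / (r + 1 - real (card C))) = r"
    if conn: "connected (with_proj G)" and rho: "graph_spectral_radius G = r"
  proof
    have tight: "adj_apply G y u = r * y u" if "u \<in> ?V" for u
      by (rule supersolution_tight[OF G ypos super ev conn rho that])
    have eqH: "adj_apply G y u = adj_apply H y u" if "u \<in> ?V" for u
      using tight[OF that] GH[of u] Hle[OF that] by linarith
    show "parcs G = J"
    proof (rule equalityI[OF GJ], rule subsetI)
      fix p assume p: "p \<in> J"
      obtain u v where uv: "p = (u, v)" by (meson surj_pair)
      have V: "u \<in> ?V" "v \<in> ?V" using p uv unfolding J_def by auto
      show "p \<in> parcs G"
      proof (rule ccontr)
        assume "p \<notin> parcs G"
        then have "adj_apply G y u < adj_apply H y u"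
          unfolding adj_apply_def H_def using GJ ypos V p uv fin
          by (simp only: pair_pre_digraph.simps, intro sum_strict_mono_ex1) (auto simp: less_imp_le)
        then show False using eqH[OF V(1)] by simp
      qed
    qed
    obtain u where u: "u \<in> S" using S by blast
    then have "u \<in> ?V" using S by blast
    then have "adj_apply H y u = r * y u" using eqH[of u] tight[of u] by simp
    then show "real (card S) - 1 + (\<Sum>C\<in>P. real (card C) * real (card S) / (r + 1 - real (card C))) = r"
      using HS[OF u] yS[OF u] by (simp add: s_def)
  qed
qed

section \<open>Inequalities for the part sizes\<close>

lemma twice_card_le_sum_plus_ones:
  fixes a :: "'b \<Rightarrow> nat"
  assumes fin: "finite P" and pos: "\<And>C. C \<in> P \<Longrightarrow> a C \<ge> 1"
  shows "2 * card P \<le> sum a P + card {C \<in> P. a C = 1}"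
proof -
  have "2 \<le> a C + (if a C = 1 then 1 else 0)" if "C \<in> P" for C
    using pos[OF that] by (cases "a C = 1") auto
  then have "(\<Sum>C\<in>P. 2) \<le> (\<Sum>C\<in>P. a C + (if a C = 1 then 1 else 0))"
    by (rule sum_mono)
  then show ?thesis using fin by (simp add: sum.distrib sum.If_cases Int_def)
qed

lemma largest_part_bound:
  fixes a :: "'b \<Rightarrow> nat"
  assumes fin: "finite P" and pos: "\<And>C. C \<in> P \<Longrightarrow> a C \<ge> 1"
    and ones: "card {C \<in> P. a C = 1} \<le> s" and "D \<in> P"
  shows "a D + 2 * card P \<le> sum a P + s + 2"
proof -
  have "2 * card (P - {D}) \<le> sum a (P - {D}) + card {C \<in> P - {D}. a C = 1}"
    using fin pos by (intro twice_card_le_sum_plus_ones) auto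
  also have "card {C \<in> P - {D}. a C = 1} \<le> card {C \<in> P. a C = 1}"
    using fin by (intro card_mono) auto
  finally have "2 * card (P - {D}) \<le> sum a (P - {D}) + s" using ones by simp
  moreover have "sum a P = a D + sum a (P - {D})" "card P = Suc (card (P - {D}))"
    using sum.remove[OF fin \<open>D \<in> P\<close>, of a] card.remove[OF fin \<open>D \<in> P\<close>] by simp_all
  ultimately show ?thesis by simp
qed

text \<open>
  This is what remains of the case \<open>s \<ge> 2\<close> after all denominators are cleared; \<open>M\<close> stands for
  \<open>n - 2 * k - 1\<close>. Measuring \<open>s\<close>, \<open>k\<close> and \<open>M\<close> from their least values turns the difference of the two
  sides into a polynomial with nonnegative coefficients. For \<open>k = 1\<close> and \<open>s = 2\<close> the general lower bound
  on \<open>M\<close> is 5, where the inequality fails, so that this case has to assume more.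
\<close>

lemma several_hubs_polynomial:
  fixes k s M :: real
  assumes "k \<ge> 1" "s \<ge> 2" "M \<ge> 2 * k * (s - 1) + 3"
    and "k \<ge> 2 \<or> k = 1 \<and> (s \<ge> 3 \<or> s = 2 \<and> M \<ge> 7)"
  shows "s * ((k * s + 2) * (2 * k * (s - 1) + 1) + M * (M + 2 * k + 1 - s - (k * s + 2)))
           \<le> (M - s) * (M - 1) * (2 * k * (s - 1) + 1)"
proof -
  let ?d = "(M - s) * (M - 1) * (2 * k * (s - 1) + 1)
      - s * ((k * s + 2) * (2 * k * (s - 1) + 1) + M * (M + 2 * k + 1 - s - (k * s + 2)))"
  from assms(4) consider "k \<ge> 2" | "k = 1" "s \<ge> 3" | "k = 1" "s = 2" "M \<ge> 7" by blast
  then have "?d \<ge> 0"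
  proof cases
    case 1
    define a b t where "a = s - 2" and "b = k - 2" and "t = M - (2 * k * (s - 1) + 3)"
    have nn: "a \<ge> 0" "b \<ge> 0" "t \<ge> 0" using 1 assms by (simp_all add: a_def b_def t_def)
    have "s = a + 2" "k = b + 2" "M = 2 * (b + 2) * (a + 1) + 3 + t"
      by (simp_all add: a_def b_def t_def)
    then have "?d = 34 + 33 * t + 3 * t^2 + 82 * b + 34 * b * t + 2 * b * t^2 + 48 * b^2 + 8 * b^2 * t + 8 * b^3 + 138 * a + 58 * a * t + 3 * a * t^2 + 252 * a * b + 62 * a * b * t + 2 * a * b * t^2 + 140 * a * b^2 + 16 * a * b^2 * t + 24 * a * b^3 + 131 * a^2 + 23 * a^2 * t + 232 * a^2 * b + 27 * a^2 * b * t + 132 * a^2 * b^2 + 8 * a^2 * b^2 * t + 24 * a^2 * b^3 + 36 * a^3 + 66 * a^3 * b + 40 * a^3 * b^2 + 8 * a^3 * b^3"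
      by (simp add: algebra_simps power2_eq_square power3_eq_cube)
    also have "\<dots> \<ge> 0" using nn by (intro add_nonneg_nonneg mult_nonneg_nonneg zero_le_power) auto
    finally show ?thesis .
  next
    case 2
    define a t where "a = s - 3" and "t = M - (2 * s + 1)"
    have nn: "a \<ge> 0" "t \<ge> 0" using 2 assms by (simp_all add: a_def t_def algebra_simps)
    have "s = a + 3" "k = 1" "M = 2 * a + 7 + t"
      using 2 by (simp_all add: a_def t_def)
    then have "?d = 3 + 23 * t + 2 * t^2 + 22 * a + 20 * a * t + 1 * a * t^2 + 13 * a^2 + 4 * a^2 * t + 2 * a^3"
      by (simp add: algebra_simps power2_eq_square power3_eq_cube)
    also have "\<dots> \<ge> 0" using nn by (intro add_nonneg_nonneg mult_nonneg_nonneg zero_le_power) auto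
    finally show ?thesis .
  next
    case 3
    define t where "t = M - 7"
    have nn: "t \<ge> 0" using 3 by (simp add: t_def)
    have "s = 2" "k = 1" "M = 7 + t" using 3 by (simp_all add: t_def)
    then have "?d = 10 + 11 * t + 1 * t^2"
      by (simp add: algebra_simps power2_eq_square power3_eq_cube)
    also have "\<dots> \<ge> 0" using nn by (intro add_nonneg_nonneg mult_nonneg_nonneg zero_le_power) auto
    finally show ?thesis .
  qed
  then show ?thesis by simp
qed

text \<open>
  By convexity \<open>x / (M - x)\<close> lies below its chord on the interval from \<open>1\<close> to \<open>M - D\<close>, where
  \<open>M - D = n - 2 * k * s - 2\<close> is the largest possible part size. Summed over the parts, the chord bound
  depends only on the number of parts and decreases with it, so the least number \<open>k * s + 2\<close> is the
  worst case.
\<close>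

lemma several_hubs_bound:
  fixes a :: "'b \<Rightarrow> nat" and k s n :: nat
  assumes fin: "finite P" and pos: "\<And>C. C \<in> P \<Longrightarrow> a C \<ge> 1"
    and ones: "card {C \<in> P. a C = 1} \<le> s" and n: "sum a P + s = n" and c: "k * s + 2 \<le> card P"
    and k: "k \<ge> 1" and s: "s \<ge> 2" and n10: "k = 1 \<Longrightarrow> n \<ge> 10"
  defines "r \<equiv> real n - 2 * real k - 2"
  shows "\<And>C. C \<in> P \<Longrightarrow> real (a C) < r + 1"
    and "real s - 1 + (\<Sum>C\<in>P. real (a C) * real s / (r + 1 - real (a C))) \<le> r"
proof -
  define M where "M = r + 1"
  define D where "D = 2 * real k * (real s - 1) + 1"
  have big: "a C + 2 * (k * s) + 2 \<le> n" if "C \<in> P" for C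
    using largest_part_bound[OF fin pos ones that] c n by linarith
  have aM: "real (a C) \<le> M - D" if "C \<in> P" for C
  proof -
    have "real (a C + 2 * (k * s) + 2) \<le> real n" using big[OF that] by (rule of_nat_mono)
    then have "real (a C) + 2 * (real k * real s) + 2 \<le> real n" by simp
    then show ?thesis by (simp add: M_def D_def r_def algebra_simps)
  qed
  have D1: "D \<ge> 1" using s by (simp add: D_def)
  show "real (a C) < r + 1" if "C \<in> P" for C
    using aM[OF that] D1 by (simp add: M_def)
  have "2 * (k * s) + 4 \<le> n"
  proof -
    have "2 * card P \<le> sum a P + card {C \<in> P. a C = 1}"
      using pos by (rule twice_card_le_sum_plus_ones[OF fin])
    then show ?thesis using ones n c by linarith
  qed
  then have "real (2 * (k * s) + 4) \<le> real n" by (rule of_nat_mono)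
  then have "2 * (real k * real s) + 4 \<le> real n" by simp
  then have MD: "M \<ge> D + 2" by (simp add: M_def D_def r_def algebra_simps)
  have M1: "M > 1" using MD D1 by simp
  have chord: "real (a C) / (M - real (a C)) \<le> 1 / (M - 1) + (real (a C) - 1) * (M / ((M - 1) * D))"
    if C: "C \<in> P" for C
  proof -
    define x where "x = real (a C)"
    have x: "1 \<le> x" "D \<le> M - x" using pos[OF C] aM[OF C] by (simp_all add: x_def)
    have "x / (M - x) = 1 / (M - 1) + (x - 1) * (M / ((M - 1) * (M - x)))"
    proof -
      have "M - x \<noteq> 0" "M - 1 \<noteq> 0" using x D1 M1 by auto
      then have "1 / (M - 1) + (x - 1) * (M / ((M - 1) * (M - x))) = (M - x + (x - 1) * M) / ((M - 1) * (M - x))"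
        by (simp add: add_divide_distrib)
      also have "M - x + (x - 1) * M = x * (M - 1)" by (simp add: algebra_simps)
      finally show ?thesis using \<open>M - 1 \<noteq> 0\<close> by simp
    qed
    also have "M / ((M - 1) * (M - x)) \<le> M / ((M - 1) * D)"
      using x D1 M1 by (intro divide_left_mono mult_left_mono mult_pos_pos) auto
    finally show ?thesis using x by (simp add: x_def mult_left_mono)
  qed
  define cc where "cc = real (card P)"
  have cc: "cc \<ge> real k * real s + 2"
    using of_nat_mono[OF c, where 'a = real] by (simp add: cc_def)
  have sa: "(\<Sum>C\<in>P. real (a C)) = real n - real s"
    using n by (metis add_diff_cancel_right' of_nat_add of_nat_sum)
  have "(\<Sum>C\<in>P. real (a C) / (M - real (a C))) \<le>
      (\<Sum>C\<in>P. 1 / (M - 1) + (real (a C) - 1) * (M / ((M - 1) * D)))"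
    by (rule sum_mono) (rule chord)
  also have "\<dots> = cc / (M - 1) + (real n - real s - cc) * (M / ((M - 1) * D))"
    unfolding sum.distrib sum_distrib_right[symmetric] sum_subtractf sa by (simp add: cc_def)
  also have "\<dots> = (cc * D + M * (real n - real s - cc)) / ((M - 1) * D)"
    using M1 D1 by (simp add: add_divide_distrib mult.commute)
  also have "\<dots> \<le> ((real k * real s + 2) * D + M * (real n - real s - (real k * real s + 2))) / ((M - 1) * D)"
  proof (rule divide_right_mono)
    have "(cc - (real k * real s + 2)) * (M - D) \<ge> 0" using cc MD by simp
    then show "cc * D + M * (real n - real s - cc) \<le>
        (real k * real s + 2) * D + M * (real n - real s - (real k * real s + 2))"
      by (simp add: algebra_simps)
  qed (use M1 D1 in simp)
  finally have sum_le: "(\<Sum>C\<in>P. real (a C) / (M - real (a C))) \<le>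
      ((real k * real s + 2) * D + M * (real n - real s - (real k * real s + 2))) / ((M - 1) * D)" .
  have "real s * (\<Sum>C\<in>P. real (a C) / (M - real (a C))) \<le>
      real s * (((real k * real s + 2) * D + M * (real n - real s - (real k * real s + 2))) / ((M - 1) * D))"
    by (rule mult_left_mono[OF sum_le]) simp
  also have "\<dots> \<le> M - real s"
  proof -
    have nM: "real n - real s - (real k * real s + 2) = M + 2 * real k + 1 - real s - (real k * real s + 2)"
      by (simp add: M_def r_def)
    have "real k \<ge> 2 \<or> real k = 1 \<and> (real s \<ge> 3 \<or> real s = 2 \<and> M \<ge> 7)"
    proof (cases "k = 1")
      case True
      then have "M \<ge> 7" using n10 by (simp add: M_def r_def)
      moreover have "real s \<ge> 3 \<or> real s = 2" using s by (cases "s = 2") auto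
      ultimately show ?thesis using True by auto
    qed (use k in auto)
    then have "real s * ((real k * real s + 2) * D + M * (real n - real s - (real k * real s + 2)))
        \<le> (M - real s) * (M - 1) * D"
      unfolding nM D_def using k s MD by (intro several_hubs_polynomial) (auto simp: D_def)
    then show ?thesis using M1 D1 by (simp add: divide_le_eq mult.assoc)
  qed
  finally show "real s - 1 + (\<Sum>C\<in>P. real (a C) * real s / (r + 1 - real (a C))) \<le> r"
    by (simp add: M_def sum_distrib_left mult.commute)
qed

text \<open>
  Now \<open>\<phi> x = x / (M - x)\<close> is compared with its chord on the interval from \<open>2\<close> to \<open>L\<close>, which has slope
  \<open>\<sigma>\<close> (for \<open>L = 2\<close> it is the tangent); a part with one vertex is treated separately, by the correction term in the majorant \<open>w\<close>. The
  sizes \<open>1, 2, ..., 2, L\<close> attain the bound. Compared with them, having no one-vertex part loses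
  \<open>\<phi> 1 - \<phi> 2 + \<sigma>\<close>, and each part beyond \<open>k + 2\<close> loses \<open>2 * \<sigma> - \<phi> 2\<close>; both quantities are positive by strict
  convexity. So equality forces \<open>k + 2\<close> parts, exactly one of them with one vertex, and the other
  sizes at the ends \<open>2\<close> and \<open>L\<close> of the chord; the total size then leaves room for a single \<open>L\<close>.
\<close>

lemma one_hub_bound:
  fixes a :: "'b \<Rightarrow> nat" and k n L :: nat and r :: real
  assumes fin: "finite P" and pos: "\<And>C. C \<in> P \<Longrightarrow> a C \<ge> 1"
    and ones: "card {C \<in> P. a C = 1} \<le> 1" and n: "sum a P + 1 = n" and c: "k + 2 \<le> card P"
    and L: "n = L + 2 * k + 2" "L \<ge> 2"
    and r: "r > real L" "r = 1 / r + 2 * real k / (r - 1) + real L / (r + 1 - real L)"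
  shows "\<And>C. C \<in> P \<Longrightarrow> real (a C) < r + 1"
    and "(\<Sum>C\<in>P. real (a C) / (r + 1 - real (a C))) \<le> r"
    and "(\<Sum>C\<in>P. real (a C) / (r + 1 - real (a C))) = r \<Longrightarrow>
          card P = k + 2 \<and> (\<exists>C1\<in>P. \<exists>CL\<in>P. C1 \<noteq> CL \<and> a C1 = 1 \<and> a CL = L \<and> (\<forall>C\<in>P - {C1, CL}. a C = 2))"
proof -
  define M where "M = r + 1"
  define \<sigma> where "\<sigma> = M / ((M - real L) * (M - 2))"
  define \<phi> where "\<phi> x = x / (M - x)" for x
  define i where "i = card {C \<in> P. a C = 1}"
  define d where "d = real (card P) - real k - 2"
  have aL: "a C \<le> L" if "C \<in> P" for C
    using largest_part_bound[OF fin pos ones that] c n L by linarith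
  show "real (a C) < r + 1" if "C \<in> P" for C
    using aL[OF that] r(1) by linarith
  have M_gt: "M - real L > 1" "M > 3" using r(1) L(2) by (simp_all add: M_def)
  have phi_chord: "\<phi> x = \<phi> 2 + (x - 2) * (M / ((M - x) * (M - 2)))" if "x < M" for x
  proof -
    have nz: "M - x \<noteq> 0" "M - 2 \<noteq> 0" using that M_gt by auto
    have "2 / (M - 2) = 2 * (M - x) / ((M - x) * (M - 2))"
      using mult_divide_mult_cancel_left[OF nz(1), of 2 "M - 2"] by (simp only: mult.commute[of 2])
    with nz have "2 / (M - 2) + (x - 2) * (M / ((M - x) * (M - 2))) = (2 * (M - x) + (x - 2) * M) / ((M - x) * (M - 2))"
      unfolding add_divide_distrib by simp
    also have "2 * (M - x) + (x - 2) * M = x * (M - 2)" by (simp add: algebra_simps)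
    finally show ?thesis using nz by (simp add: \<phi>_def)
  qed
  have phi_L: "\<phi> (real L) = \<phi> 2 + (real L - 2) * \<sigma>"
    unfolding \<sigma>_def using M_gt by (intro phi_chord) simp
  define w where "w x = \<phi> 2 + (real x - 2) * \<sigma> + (if x = 1 then \<phi> 1 - \<phi> 2 + \<sigma> else 0)" for x :: nat
  have w_ge: "\<phi> (real x) \<le> w x" and w_eq: "\<phi> (real x) = w x \<Longrightarrow> x \<in> {1, 2, L}" if x: "1 \<le> x" "x \<le> L" for x
  proof -
    have "\<phi> (real x) \<le> w x \<and> (\<phi> (real x) = w x \<longrightarrow> x \<in> {1, 2, L})"
    proof (cases "x = 1 \<or> x = 2 \<or> x = L")
      case True
      then show ?thesis using phi_L L(2) by (auto simp: w_def)
    next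
      case False
      have "M / ((M - real x) * (M - 2)) < \<sigma>"
        unfolding \<sigma>_def using x False M_gt by (intro divide_strict_left_mono mult_strict_right_mono mult_pos_pos) auto
      then have "(real x - 2) * (M / ((M - real x) * (M - 2))) < (real x - 2) * \<sigma>"
        using x False by (intro mult_strict_left_mono) auto
      moreover have "real x < M" using x M_gt by simp
      ultimately have "\<phi> (real x) < w x" using phi_chord[of "real x"] False by (simp add: w_def)
      then show ?thesis by simp
    qed
    then show "\<phi> (real x) \<le> w x" "\<phi> (real x) = w x \<Longrightarrow> x \<in> {1, 2, L}" by blast+
  qed
  have gain1: "\<phi> 1 - \<phi> 2 + \<sigma> > 0"
  proof -
    have "\<phi> 2 - \<phi> 1 = M / ((M - 1) * (M - 2))" using phi_chord[of 1] M_gt by simp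
    also have "\<dots> < \<sigma>" unfolding \<sigma>_def using M_gt L(2)
      by (intro divide_strict_left_mono mult_strict_right_mono mult_pos_pos) auto
    finally show ?thesis by simp
  qed
  have gain2: "2 * \<sigma> - \<phi> 2 > 0"
  proof -
    have "1 < M / (M - real L)" using M_gt L(2) by simp
    then have "2 / (M - 2) * 1 < 2 / (M - 2) * (M / (M - real L))" using M_gt by (intro mult_strict_left_mono) auto
    also have "\<dots> = 2 * \<sigma>" by (simp add: \<sigma>_def)
    finally show ?thesis by (simp add: \<phi>_def)
  qed
  have d0: "d \<ge> 0" using c by (simp add: d_def)
  have i1: "real i \<le> 1" using ones by (simp add: i_def)
  have sa: "(\<Sum>C\<in>P. real (a C)) = real L + 2 * real k + 1"
    using n L(1) by (simp flip: of_nat_sum)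
  have "(\<Sum>C\<in>P. w (a C)) = (\<Sum>C\<in>P. \<phi> 2) + (\<Sum>C\<in>P. real (a C) * \<sigma>) - (\<Sum>C\<in>P. 2 * \<sigma>)
      + (\<Sum>C\<in>P. if a C = 1 then \<phi> 1 - \<phi> 2 + \<sigma> else 0)"
    by (simp add: w_def sum.distrib sum_subtractf left_diff_distrib)
  also have "(\<Sum>C\<in>P. if a C = 1 then \<phi> 1 - \<phi> 2 + \<sigma> else 0) = real i * (\<phi> 1 - \<phi> 2 + \<sigma>)"
    using fin by (simp add: sum.If_cases Int_def i_def)
  also have "(\<Sum>C\<in>P. real (a C) * \<sigma>) = (real L + 2 * real k + 1) * \<sigma>"
    by (simp add: sa flip: sum_distrib_right)
  finally have sw: "(\<Sum>C\<in>P. w (a C)) = real (card P) * \<phi> 2 + (real L + 2 * real k + 1) * \<sigma>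
      - real (card P) * (2 * \<sigma>) + real i * (\<phi> 1 - \<phi> 2 + \<sigma>)" by simp
  have "r = \<phi> 1 + real k * \<phi> 2 + \<phi> (real L)"
    using r(2) by (simp add: \<phi>_def M_def mult.commute[of 2])
  then have gap: "r - (\<Sum>C\<in>P. w (a C)) = (1 - real i) * (\<phi> 1 - \<phi> 2 + \<sigma>) + d * (2 * \<sigma> - \<phi> 2)"
    unfolding sw phi_L by (simp add: d_def algebra_simps)
  have le_w: "(\<Sum>C\<in>P. \<phi> (real (a C))) \<le> (\<Sum>C\<in>P. w (a C))"
    using w_ge pos aL by (intro sum_mono) blast
  have nn: "(1 - real i) * (\<phi> 1 - \<phi> 2 + \<sigma>) \<ge> 0" "d * (2 * \<sigma> - \<phi> 2) \<ge> 0"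
    using gain1 gain2 d0 i1 by simp_all
  show "(\<Sum>C\<in>P. real (a C) / (r + 1 - real (a C))) \<le> r"
    using le_w gap nn by (simp add: \<phi>_def M_def)
  assume "(\<Sum>C\<in>P. real (a C) / (r + 1 - real (a C))) = r"
  then have "(\<Sum>C\<in>P. \<phi> (real (a C))) = r" by (simp add: \<phi>_def M_def)
  then have z: "(1 - real i) * (\<phi> 1 - \<phi> 2 + \<sigma>) = 0" "d * (2 * \<sigma> - \<phi> 2) = 0"
    and sums: "(\<Sum>C\<in>P. \<phi> (real (a C))) = (\<Sum>C\<in>P. w (a C))"
    using le_w gap nn by linarith+
  have "i = 1" "d = 0" using z gain1 gain2 by auto
  then have cP: "card P = k + 2" unfolding d_def by linarith
  have tight: "a C \<in> {1, 2, L}" if "C \<in> P" for C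
  proof -
    have "(\<Sum>C\<in>P. w (a C) - \<phi> (real (a C))) = 0" using sums by (simp add: sum_subtractf)
    then have "w (a C) - \<phi> (real (a C)) = 0"
      using w_ge pos aL that by (subst (asm) sum_nonneg_eq_0_iff[OF fin]) auto
    then show ?thesis using w_eq[of "a C"] pos[OF that] aL[OF that] by simp
  qed
  obtain C1 where C1: "{C \<in> P. a C = 1} = {C1}"
    using \<open>i = 1\<close> unfolding i_def by (auto simp: card_1_singleton_iff)
  define Q where "Q = P - {C1}"
  have C1P: "C1 \<in> P" "a C1 = 1" using C1 by auto
  have Q2: "a C = 2 \<or> a C = L" if "C \<in> Q" for C
  proof -
    have "a C \<noteq> 1" using that C1 unfolding Q_def by blast
    then show ?thesis using tight[of C] that unfolding Q_def by auto
  qed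
  have finQ: "finite Q" and cQ: "card Q = k + 1"
    using fin C1P cP by (simp_all add: Q_def)
  have sQ: "sum a Q = L + 2 * k" using n L(1) C1P fin by (simp add: Q_def sum.remove)
  have "\<exists>CL\<in>Q. a CL = L \<and> (\<forall>C\<in>Q - {CL}. a C = 2)"
  proof -
    \<comment> \<open>For \<open>L = 2\<close> all parts in \<open>Q\<close> have size \<open>L\<close> and any of them can be chosen.\<close>
    have "\<exists>CL\<in>Q. a CL = L"
    proof (rule ccontr)
      assume neg: "\<not> ?thesis"
      then have "sum a Q = (\<Sum>C\<in>Q. 2)" using Q2 by (intro sum.cong) auto
      then have "L = 2" using sQ cQ by simp
      moreover obtain C where "C \<in> Q" using cQ by fastforce
      ultimately show False using neg Q2 by blast
    qed
    then obtain CL where CL: "CL \<in> Q" "a CL = L" by blast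
    have "sum a (Q - {CL}) = (\<Sum>C\<in>Q - {CL}. 2)"
      using sQ cQ finQ CL by (simp add: sum.remove)
    moreover have "2 \<le> a C" if "C \<in> Q - {CL}" for C using Q2[of C] L(2) that by auto
    ultimately have "\<forall>C\<in>Q - {CL}. a C = 2"
      using sum_mono_inv[of "\<lambda>_. 2" "Q - {CL}" a] finQ by (metis finite_Diff)
    then show ?thesis using CL by blast
  qed
  then obtain CL where "CL \<in> Q" "a CL = L" "\<forall>C\<in>Q - {CL}. a C = 2" by blast
  then have "CL \<in> P" "C1 \<noteq> CL" "\<forall>C\<in>P - {C1, CL}. a C = 2" unfolding Q_def by auto
  then show "card P = k + 2 \<and> (\<exists>C1\<in>P. \<exists>CL\<in>P. C1 \<noteq> CL \<and> a C1 = 1 \<and> a CL = L \<and> (\<forall>C\<in>P - {C1, CL}. a C = 2))"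
    using cP C1P \<open>a CL = L\<close> by blast
qed

section \<open>Recognizing the extremal graph\<close>

lemma digraph_isoI:
  assumes G: "pair_graph G" and bij: "bij_betw h (pverts G) (pverts H)"
    and arcs: "\<And>u v. u \<in> pverts G \<Longrightarrow> v \<in> pverts G \<Longrightarrow> (u, v) \<in> parcs G \<longleftrightarrow> (h u, h v) \<in> parcs H"
    and wfH: "parcs H \<subseteq> pverts H \<times> pverts H"
  shows "digraph_iso (with_proj G) (with_proj H)"
proof -
  have wf: "parcs G \<subseteq> pverts G \<times> pverts G" using G by (simp add: pair_graph_iff)
  have inj: "inj_on h (pverts G)" and im: "h ` pverts G = pverts H"
    using bij by (auto simp: bij_betw_def)
  define I where "I = \<lparr>iso_verts = h, iso_arcs = map_prod h h, iso_head = snd, iso_tail = fst\<rparr>"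
  have "inj_on (map_prod h h) (parcs G)"
    using inj_on_subset[OF map_prod_inj_on[OF inj inj] wf] .
  moreover have "wf_digraph (with_proj G)"
    using G unfolding wf_digraph_wp_iff by (simp add: pair_graph_def pair_digraph_def pair_fin_digraph_def)
  ultimately have "pre_digraph.digraph_isomorphism (with_proj G) I"
    unfolding pre_digraph.digraph_isomorphism_def I_def using inj by simp
  moreover have "map_prod h h ` parcs G = parcs H"
  proof
    show "map_prod h h ` parcs G \<subseteq> parcs H" using wf arcs by auto
    show "parcs H \<subseteq> map_prod h h ` parcs G"
    proof
      fix p assume p: "p \<in> parcs H"
      then obtain u v where "p = (h u, h v)" "u \<in> pverts G" "v \<in> pverts G"
        using wfH unfolding im[symmetric] by blast
      then show "p \<in> map_prod h h ` parcs G" using p arcs[of u v] by (intro image_eqI[of _ _ "(u, v)"]) auto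
    qed
  qed
  then have "with_proj H = app_iso I (with_proj G)"
    unfolding app_iso_def I_def with_proj_def by (simp add: im)
  ultimately show ?thesis unfolding digraph_iso_def by blast
qed

text \<open>
  Inside each part an arbitrary numbering \<open>e\<close> of its vertices can be used, since all parts are cliques;
  the parts of order two are numbered by \<open>q\<close>. The function \<open>kind\<close> labels the vertices of the extremal
  graph by the hub (label 0) or the clique that they belong to, so that adjacency in it becomes the
  same condition on labels as adjacency in \<open>G\<close> is on parts.
\<close>

lemma extremal_graph_iso:
  fixes G :: "'a pair_pre_digraph" and k L :: nat
  assumes G: "pair_graph G" and n: "card (pverts G) = L + 2 * k + 2"
    and v: "v \<in> pverts G" and P: "disjoint P" "\<Union>P = pverts G - {v}" "card P = k + 2"
    and C1: "C1 \<in> P" "card C1 = 1" and CL: "CL \<in> P" "card CL = L" and ne: "C1 \<noteq> CL"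
    and pairs: "\<And>C. C \<in> P - {C1, CL} \<Longrightarrow> card C = 2"
    and arcs: "parcs G = {(x, y). x \<in> pverts G \<and> y \<in> pverts G \<and> x \<noteq> y \<and>
                  (x \<in> {v} \<or> y \<in> {v} \<or> (\<exists>C\<in>P. x \<in> C \<and> y \<in> C))}"
  shows "digraph_iso (with_proj G) (with_proj (extremal_graph (L + 2 * k + 2) k))"
proof -
  let ?V = "pverts G" and ?H = "extremal_graph (L + 2 * k + 2) k"
  have fin: "finite ?V" using G by (simp add: pair_graph_iff)
  have finP: "finite P" using fin P(2) by (metis finite_Diff finite_UnionD)
  have finC: "finite C" if "C \<in> P" for C
    using that fin P(2) by (metis Sup_upper finite_Diff finite_subset)
  define Q where "Q = P - {C1, CL}"
  have "card Q = k" unfolding Q_def using finP C1 CL ne P(3) by (simp add: card_Diff_subset)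
  then obtain q where q: "bij_betw q Q {..<k}"
    using finP unfolding Q_def by (metis finite_Diff finite_same_card_bij finite_lessThan card_lessThan)
  have "\<exists>e. bij_betw e C {..<card C}" if "C \<in> P" for C
    using finC[OF that] by (metis finite_same_card_bij finite_lessThan card_lessThan)
  then obtain e where e: "\<And>C. C \<in> P \<Longrightarrow> bij_betw (e C) C {..<card C}" by metis
  define part where "part x = (THE C. C \<in> P \<and> x \<in> C)" for x
  have part: "part x = C" if "C \<in> P" "x \<in> C" for x C
    unfolding part_def using that P(1) by (intro the_equality) (auto simp: disjoint_def)
  have part_in: "part x \<in> P" "x \<in> part x" if "x \<in> ?V" "x \<noteq> v" for x
  proof -
    have "x \<in> \<Union>P" using that P(2) by simp
    then obtain C where C: "C \<in> P" "x \<in> C" by blast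
    then show "part x \<in> P" "x \<in> part x" using part[OF C] by simp_all
  qed
  define h :: "'a \<Rightarrow> nat + ((nat + nat \<times> nat) + nat)" where
    "h x = (if x = v then Inl 0 else if part x = C1 then Inr (Inr 0)
       else if part x = CL then Inr (Inl (Inl (e CL x)))
       else Inr (Inl (Inr (q (part x), e (part x) x))))" for x
  have verts: "pverts ?H = {..<1} <+> (({..<L} <+> {..<k} \<times> {..<2}) <+> {..<1})"
    by (simp add: extremal_graph_def graph_join_def disjoint_union_def complete_graph_def copies_def)
  have Harcs: "parcs ?H = parcs (graph_join (complete_graph 1) (disjoint_union
      (disjoint_union (complete_graph L) (copies k (complete_graph 2))) (complete_graph 1)))"
    by (simp add: extremal_graph_def)
  define kind :: "nat + ((nat + nat \<times> nat) + nat) \<Rightarrow> nat" where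
    "kind = case_sum (\<lambda>_. 0) (case_sum (case_sum (\<lambda>_. 1) (\<lambda>p. fst p + 3)) (\<lambda>_. 2))"
  have H_arc: "(z, w) \<in> parcs ?H \<longleftrightarrow>
      z \<in> pverts ?H \<and> w \<in> pverts ?H \<and> z \<noteq> w \<and> (kind z = 0 \<or> kind w = 0 \<or> kind z = kind w)" for z w
  proof -
    note defs = graph_join_def disjoint_union_def complete_graph_def copies_def Plus_def image_iff kind_def
    have shapes: "(\<exists>a. z = Inl a) \<or> (\<exists>i. z = Inr (Inl (Inl i))) \<or> (\<exists>j b. z = Inr (Inl (Inr (j, b)))) \<or>
        (\<exists>c. z = Inr (Inr c))" for z :: "nat + ((nat + nat \<times> nat) + nat)"
      by (metis sum.exhaust surj_pair)
    from shapes[of z] shapes[of w] show ?thesis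
      unfolding Harcs verts
      by (elim disjE exE) ((simp_all (no_asm_simp) add: defs), auto)
  qed
  have kind_h: "kind (h x) = (if x = v then 0 else if part x = C1 then 2 else if part x = CL then 1
      else q (part x) + 3)" for x
    by (simp add: kind_def h_def)
  have same_kind: "kind (h x) = kind (h y) \<longleftrightarrow> part x = part y"
    if x: "x \<in> ?V" "x \<noteq> v" and y: "y \<in> ?V" "y \<noteq> v" for x y
  proof -
    have "q (part x) = q (part y) \<longleftrightarrow> part x = part y" if "part x \<in> Q" "part y \<in> Q"
      using q that by (auto simp: bij_betw_def dest: inj_onD)
    then show ?thesis
      using part_in(1)[OF x] part_in(1)[OF y] x y ne unfolding kind_h Q_def by auto
  qed
  have inj: "inj_on h ?V"
  proof (rule inj_onI)
    fix x y assume x: "x \<in> ?V" and y: "y \<in> ?V" and eq: "h x = h y"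
    show "x = y"
    proof (cases "x = v \<or> y = v")
      case True
      then show ?thesis using eq by (auto simp: h_def split: if_splits)
    next
      case False
      define C where "C = part x"
      have C: "part y = C" "C \<in> P" "x \<in> C" "y \<in> C"
        using same_kind[of x y] part_in[of x] part_in[of y] False x y eq by (auto simp: C_def)
      have "C = C1 \<or> e C x = e C y"
        using eq False C(1) by (auto simp: h_def C_def split: if_splits)
      then show ?thesis
      proof
        assume "C = C1"
        then show ?thesis using C C1(2) by (auto simp: card_1_singleton_iff)
      next
        assume "e C x = e C y"
        then show ?thesis using e[OF C(2)] C by (auto simp: bij_betw_def dest: inj_onD)
      qed
    qed
  qed
  have im: "h ` ?V \<subseteq> pverts ?H"
  proof
    fix z assume "z \<in> h ` ?V"
    then obtain x where x: "x \<in> ?V" "z = h x" by blast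
    show "z \<in> pverts ?H"
    proof (cases "x = v \<or> part x = C1")
      case True
      then show ?thesis unfolding x(2) verts by (auto simp: h_def)
    next
      case False
      then have in_e: "e (part x) x < card (part x)"
        using e[OF part_in(1)] part_in(2) x by (auto simp: bij_betw_def)
      show ?thesis
      proof (cases "part x = CL")
        case True
        then show ?thesis using in_e False CL(2) unfolding x(2) verts by (auto simp: h_def)
      next
        case False
        with \<open>\<not> (x = v \<or> part x = C1)\<close> have "part x \<in> Q" using part_in x unfolding Q_def by auto
        then have "q (part x) < k" "e (part x) x < 2"
          using in_e q pairs[of "part x"] unfolding Q_def by (auto simp: bij_betw_def)
        then show ?thesis
          using False \<open>\<not> (x = v \<or> part x = C1)\<close> unfolding x(2) verts by (auto simp: h_def)
      qed
    qed
  qed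
  have fin_ext: "finite (pverts ?H)" using pair_graph_extremal_graph by (auto simp: pair_graph_iff)
  have "h ` ?V = pverts ?H"
  proof (rule card_subset_eq[OF fin_ext im])
    show "card (h ` ?V) = card (pverts ?H)"
      using card_image[OF inj] n card_extremal_graph[of k "L + 2 * k + 2"] by simp
  qed
  then have bij: "bij_betw h ?V (pverts ?H)" using inj by (simp add: bij_betw_def)
  show ?thesis
  proof (rule digraph_isoI[OF G bij])
    show "parcs ?H \<subseteq> pverts ?H \<times> pverts ?H"
      using pair_graph_extremal_graph unfolding pair_graph_iff by blast
    fix x y assume x: "x \<in> ?V" and y: "y \<in> ?V"
    have "h x \<in> pverts ?H" "h y \<in> pverts ?H" using im x y by auto
    moreover have "h x = h y \<longleftrightarrow> x = y" using inj x y by (auto dest: inj_onD)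
    moreover have zero: "kind (h z) = 0 \<longleftrightarrow> z = v" for z by (simp add: kind_h)
    moreover have "(\<exists>C\<in>P. x \<in> C \<and> y \<in> C) \<longleftrightarrow> kind (h x) = kind (h y)" if "x \<noteq> v" "y \<noteq> v"
      unfolding same_kind[OF x that(1) y that(2)]
      using part part_in[OF x that(1)] part_in[OF y that(2)] by metis
    ultimately show "(x, y) \<in> parcs G \<longleftrightarrow> (h x, h y) \<in> parcs ?H"
      unfolding H_arc zero arcs using x y by auto
  qed
qed

section \<open>The extremal theorem\<close>

text \<open>
  The extremal eigenvalue \<open>r > L\<close> is a lower bound for the spectral radius of \<open>G\<close>. With at least two
  vertices in \<open>S\<close> the upper bound is \<open>L\<close>, which is impossible; with a single one it is \<open>r\<close>, and the
  equality case determines \<open>G\<close>.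
\<close>

lemma many_parts_imp_extremal:
  fixes k :: nat and G :: "'a pair_pre_digraph"
  assumes k: "k > 0" and G: "pair_graph G" and conn: "connected (with_proj G)"
    and bind: "r_binding 1 G"
    and n_ge: "card (pverts G) \<ge> (if k = 1 then 10 else 2 * k + 4)"
    and rho: "graph_spectral_radius G \<ge> graph_spectral_radius (extremal_graph (card (pverts G)) k)"
    and S: "S \<noteq> {}" "S \<subseteq> pverts G" and P0: "closed_parts (parcs G) (pverts G) S P0"
    and many: "k * card S + 2 \<le> card P0"
  shows "digraph_iso (with_proj G) (with_proj (extremal_graph (card (pverts G)) k))"
proof -
  define n where "n = card (pverts G)"
  define s where "s = card S"
  define L where "L = n - 2 * k - 2"
  have n: "n = L + 2 * k + 2" and L: "L \<ge> 2"
    using n_ge unfolding L_def n_def by (auto split: if_splits)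
  have fin: "finite (pverts G)" and sym: "sym (parcs G)" using G by (simp_all add: pair_graph_iff)
  have finS: "finite S" using S(2) fin finite_subset by blast
  have "P0 \<noteq> {}" using many by auto
  then obtain P where P: "closed_parts (parcs G) (pverts G) S P" and cover: "\<Union>P = pverts G - S"
    and "card P = card P0"
    using closed_parts_extend_to_cover[OF fin sym P0] by blast
  with many have c: "k * s + 2 \<le> card P" by (simp add: s_def)
  have disj: "disjoint P" "{} \<notin> P" using P by (simp_all add: closed_parts_def)
  have finP: "finite P" using fin cover by (metis finite_Diff finite_UnionD)
  have finC: "finite C" if "C \<in> P" for C
    using that fin cover by (metis Sup_upper finite_Diff finite_subset)
  have pos: "card C \<ge> 1" if "C \<in> P" for C
    using finC[OF that] disj(2) that by (metis One_nat_def Suc_leI card_gt_0_iff)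
  have "sum card P = card (\<Union>P)"
    using disj(1) finC by (simp add: card_Union_disjoint)
  then have sum: "sum card P + s = n"
    unfolding cover s_def n_def using S(2) fin by (simp add: card_Diff_subset finS card_mono)
  have ones: "card {C \<in> P. card C = 1} \<le> s"
    unfolding s_def by (rule binding_singleton_parts[OF G bind S(2) P])
  obtain r where r: "r > real L" "r = 1 / r + 2 * real k / (r - 1) + real L / (r + 1 - real L)"
    using extremal_root_exists[OF L] by blast
  have "r \<le> graph_spectral_radius (extremal_graph n k)"
    unfolding n by (rule eigenvalue_le_graph_spectral_radius[OF pair_graph_extremal_graph extremal_graph_eigenvalue[OF L r]])
  with rho have r_le: "r \<le> graph_spectral_radius G" by (simp add: n_def)
  have "s \<noteq> 0" using S(1) finS by (simp add: s_def)
  show ?thesis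
  proof (cases "s = 1")
    case False
    with \<open>s \<noteq> 0\<close> have "s \<ge> 2" by simp
    moreover have "n \<ge> 10" if "k = 1" using n_ge that by (simp add: n_def)
    moreover have L_eq: "real n - 2 * real k - 2 = real L" by (simp add: n)
    ultimately have "real (card C) < real L + 1" if "C \<in> P" for C
      using several_hubs_bound(1)[OF finP pos ones sum c _ \<open>s \<ge> 2\<close> _ that] k by simp
    moreover have "real s - 1 + (\<Sum>C\<in>P. real (card C) * real s / (real L + 1 - real (card C))) \<le> real L"
      using several_hubs_bound(2)[OF finP pos ones sum c _ \<open>s \<ge> 2\<close>] k \<open>k = 1 \<Longrightarrow> n \<ge> 10\<close>
      unfolding L_eq by simp
    ultimately have "graph_spectral_radius G \<le> real L"
      unfolding s_def by (intro partition_spectral_bound(1)[OF G S(2,1) P cover]) auto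
    with r_le r(1) show ?thesis by simp
  next
    case True
    then obtain v where v: "S = {v}" unfolding s_def by (auto simp: card_1_singleton_iff)
    note hub = one_hub_bound[OF finP pos ones[unfolded True] sum[unfolded True] _ n L r]
    have c': "k + 2 \<le> card P" using c True by simp
    have small: "real (card C) < r + 1" if "C \<in> P" for C using hub(1)[OF _ c' that] by simp
    have le: "real (card S) - 1 + (\<Sum>C\<in>P. real (card C) * real (card S) / (r + 1 - real (card C))) \<le> r"
      using hub(2)[OF _ c'] by (simp add: v)
    have "graph_spectral_radius G \<le> r"
      by (rule partition_spectral_bound(1)[OF G S(2,1) P cover small le])
    with r_le have "graph_spectral_radius G = r" by simp
    note tight = partition_spectral_bound(2)[OF G S(2,1) P cover small le conn this]
    then have "(\<Sum>C\<in>P. real (card C) / (r + 1 - real (card C))) = r" by (simp add: v)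
    then obtain C1 CL where cP: "card P = k + 2" and C: "C1 \<in> P" "CL \<in> P" "C1 \<noteq> CL" "card C1 = 1"
      "card CL = L" "\<And>C. C \<in> P - {C1, CL} \<Longrightarrow> card C = 2"
      using hub(3)[OF _ c'] by auto
    have "digraph_iso (with_proj G) (with_proj (extremal_graph (L + 2 * k + 2) k))"
    proof (rule extremal_graph_iso[OF G])
      show "card (pverts G) = L + 2 * k + 2" using n by (simp add: n_def)
      show "v \<in> pverts G" using S(2) v by simp
      show "\<Union>P = pverts G - {v}" using cover v by simp
    qed (use tight C cP disj v in auto)
    then show ?thesis using n by (simp add: n_def)
  qed
qed

theorem theorem1p1:
  fixes k :: nat and G :: "'a pair_pre_digraph"
  assumes "k > 0" and "odd k"
    and "pair_graph G"
    and "connected (with_proj G)"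
    and "r_binding 1 G"
    and "card (pverts G) \<ge> (if k = 1 then 10 else 2 * k + 4)"
    and "graph_spectral_radius G \<ge> graph_spectral_radius (extremal_graph (card (pverts G)) k)"
  shows "(\<forall>W. W \<subseteq> pverts G \<and> even (card W) \<longrightarrow>
            (\<exists>F. pair_graph F \<and> spanning (with_proj F) (with_proj G) \<and>
               (\<forall>u\<in>W. out_degree (with_proj F) u \<in> {d. odd d \<and> d \<le> k}) \<and>
               (\<forall>v\<in>pverts G - W. out_degree (with_proj F) v \<in> {d. even d \<and> d \<le> k + 1})))
         \<or> digraph_iso (with_proj G) (with_proj (extremal_graph (card (pverts G)) k))"
proof (rule disjCI)
  assume no_iso: "\<not> digraph_iso (with_proj G) (with_proj (extremal_graph (card (pverts G)) k))"
  show "\<forall>W. W \<subseteq> pverts G \<and> even (card W) \<longrightarrow>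
            (\<exists>F. pair_graph F \<and> spanning (with_proj F) (with_proj G) \<and>
               (\<forall>u\<in>W. out_degree (with_proj F) u \<in> {d. odd d \<and> d \<le> k}) \<and>
               (\<forall>v\<in>pverts G - W. out_degree (with_proj F) v \<in> {d. even d \<and> d \<le> k + 1}))"
  proof (intro allI impI, elim conjE)
    fix W assume W: "W \<subseteq> pverts G" "even (card W)"
    have none: "\<not> (\<exists>S P. S \<noteq> {} \<and> S \<subseteq> pverts G \<and> closed_parts (parcs G) (pverts G) S P \<and> k * card S + 2 \<le> card P)"
      using many_parts_imp_extremal[OF assms(1,3-7)] no_iso by blast
    show "\<exists>F. pair_graph F \<and> spanning (with_proj F) (with_proj G) \<and>
               (\<forall>u\<in>W. out_degree (with_proj F) u \<in> {d. odd d \<and> d \<le> k}) \<and>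
               (\<forall>v\<in>pverts G - W. out_degree (with_proj F) v \<in> {d. even d \<and> d \<le> k + 1})"
      by (rule disjE[OF parity_factor_or_closed_parts[OF assms(3,4,2) W]], assumption)
        (rule notE[OF none], assumption)
  qed
qed

end
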